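(* Let $V$ be a vector space of finite dimension $d$ over an algebraically closed field $\mathbb F$ of characteristic $0$, and let $\mathbf a$ and $\mathbf b$ be two compositions of $d$. The following conditions are equivalent: (a) the varieties $\mathrm{Fl}_{\mathbf a}(V)$ and $\mathrm{Fl}_{\mathbf b}(V)$ are nil-equivalent; (b) $\mathbf a$ and $\mathbf b$ can be obtained from each other by a permutation (in particular, $\mathbf a$ and $\mathbf b$ contain the same number of elements).
   Context: A composition of a positive integer $d$ is a tuple of positive integers $(a_1,\dots,a_s)$ with $a_1+\dots+a_s=d$. For a composition $\mathbf a=(a_1,\dots,a_s)$ of $d=\dim V$, $\mathrm{Fl}_{\mathbf a}(V)$ is the variety of tuples $(V_1,\dots,V_s)$ of subspaces $V_1\subset\dots\subset V_s=V$ with $\dim V_i/V_{i-1}=a_i$ for $i=1,\dots,s$ ($V_0=\{0\}$). It is a homogeneous space $\mathrm{GL}(V)/P$ with $P$ parabolic. For a parabolic subgroup $P \subset G=\mathrm{GL}(V)$ with unipotent radical $N$ and $\mathfrak n = \operatorname{Lie} N \subset \mathfrak{gl}(V)$, the group $P$ (acting by the adjoint action) has an open orbit $O_P$ in $\mathfrak n$ (Richardson). One puts $\mathcal N(G/P) = G\,O_P \subset \mathfrak{gl}(V)$, a nilpotent $G$-orbit (for $P=G$ it is $\{0\}$). Two such varieties $X_1,X_2$ are called nil-equivalent if $\mathcal N(X_1)=\mathcal N(X_2)$. *)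

theory Defs
  imports
    "HOL-Analysis.Abstract_Topology"
    "HOL-Algebra.Coset"
    "HOL-Computational_Algebra.Polynomial"
    "HOL-Combinatorics.List_Permutation"
begin

definition composition :: "nat \<Rightarrow> nat list \<Rightarrow> bool" where
  "composition d a \<longleftrightarrow> 0 < d \<and> (\<forall>x \<in> set a. 0 < x) \<and> sum_list a = d"

text \<open>The vector space \<open>V\<close> is the whole type \<open>'b\<close>, with scalar multiplication \<open>scale\<close>.
  A separate locale keeps the constants below out of the existing interpretations of
  \<open>vector_space\<close> (such as \<open>real_vector\<close>).\<close>

locale linear_group = vector_space scale
  for scale :: "'a::field \<Rightarrow> 'b::ab_group_add \<Rightarrow> 'b"
begin

definition gl :: "('b \<Rightarrow> 'b) set" where
  "gl = {X. Vector_Spaces.linear scale scale X}"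

definition GL :: "('b \<Rightarrow> 'b) monoid" where
  "GL = \<lparr>carrier = {g \<in> gl. bij g}, monoid.mult = (\<circ>), one = id\<rparr>"


subsection \<open>Zariski topology\<close>

text \<open>Polynomial functions on \<open>gl\<close>: the algebra generated by the matrix coefficients
  \<open>X \<mapsto> \<phi> (X v)\<close>, with \<open>v\<close> a vector and \<open>\<phi>\<close> a linear form.\<close>

inductive_set regular :: "(('b \<Rightarrow> 'b) \<Rightarrow> 'a) set" where
  const: "(\<lambda>_. c) \<in> regular"
| coeff: "Vector_Spaces.linear scale (*) \<phi> \<Longrightarrow> (\<lambda>X. \<phi> (X v)) \<in> regular"
| add: "p \<in> regular \<Longrightarrow> q \<in> regular \<Longrightarrow> (\<lambda>X. p X + q X) \<in> regular"
| mult: "p \<in> regular \<Longrightarrow> q \<in> regular \<Longrightarrow> (\<lambda>X. p X * q X) \<in> regular"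

definition zariski_open :: "('b \<Rightarrow> 'b) set \<Rightarrow> bool" where
  "zariski_open U \<longleftrightarrow> (\<exists>S \<subseteq> regular. U = {X \<in> gl. \<exists>p \<in> S. p X \<noteq> 0})"

lemma istopology_zariski_open: "istopology zariski_open"
  unfolding istopology_def
proof (intro conjI allI impI)
  fix U W assume "zariski_open U" "zariski_open W"
  then obtain S T where S: "S \<subseteq> regular" "U = {X \<in> gl. \<exists>p \<in> S. p X \<noteq> 0}"
    and T: "T \<subseteq> regular" "W = {X \<in> gl. \<exists>p \<in> T. p X \<noteq> 0}"
    unfolding zariski_open_def by (elim exE conjE)
  let ?R = "(\<lambda>(p, q) X. p X * q X) ` (S \<times> T)"
  have R: "(\<exists>r \<in> ?R. r X \<noteq> 0) \<longleftrightarrow> (\<exists>p \<in> S. p X \<noteq> 0) \<and> (\<exists>q \<in> T. q X \<noteq> 0)" for X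
    by simp
  have "?R \<subseteq> regular"
  proof (rule image_subsetI, clarify)
    fix p q assume "p \<in> S" "q \<in> T"
    then show "(\<lambda>X. p X * q X) \<in> regular"
      by (rule regular.mult[OF subsetD[OF S(1)] subsetD[OF T(1)]])
  qed
  moreover have "U \<inter> W = {X \<in> gl. \<exists>p \<in> ?R. p X \<noteq> 0}"
    unfolding S(2) T(2) R by (rule Set.set_eqI) (simp; blast)
  ultimately show "zariski_open (U \<inter> W)"
    unfolding zariski_open_def by (intro exI[of _ ?R] conjI)
next
  fix \<U> assume "\<forall>U \<in> \<U>. zariski_open U"
  then have "\<forall>U \<in> \<U>. \<exists>S. S \<subseteq> regular \<and> U = {X \<in> gl. \<exists>p \<in> S. p X \<noteq> 0}"
    unfolding zariski_open_def .
  then obtain S where S: "\<forall>U \<in> \<U>. S U \<subseteq> regular \<and> U = {X \<in> gl. \<exists>p \<in> S U. p X \<noteq> 0}"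
    by (rule bchoice[THEN exE])
  have "X \<in> U \<longleftrightarrow> X \<in> gl \<and> (\<exists>p \<in> S U. p X \<noteq> 0)" if "U \<in> \<U>" for U X
    using arg_cong[OF conjunct2[OF bspec[OF S that]], of "\<lambda>U. X \<in> U"] by (simp only: mem_Collect_eq)
  then have "\<Union>\<U> = {X \<in> gl. \<exists>p \<in> \<Union>(S ` \<U>). p X \<noteq> 0}"
    by (simp add: Set.set_eq_iff)
  moreover have "\<Union>(S ` \<U>) \<subseteq> regular"
    by (rule UN_least) (rule conjunct1[OF bspec[OF S]])
  ultimately show "zariski_open (\<Union>\<U>)"
    unfolding zariski_open_def by (intro exI[of _ "\<Union>(S ` \<U>)"] conjI)
qed

definition zariski :: "('b \<Rightarrow> 'b) topology" where
  "zariski = topology zariski_open"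

lemma openin_zariski: "openin zariski = zariski_open"
  by (simp add: zariski_def istopology_zariski_open)


subsection \<open>Unipotent radical and Lie algebra\<close>

definition unipotent :: "('b \<Rightarrow> 'b) \<Rightarrow> bool" where
  "unipotent g \<longleftrightarrow> (\<exists>n. \<forall>v. ((\<lambda>w. g w - w) ^^ n) v = 0)"

text \<open>The greatest closed connected normal unipotent subgroup of \<open>P\<close>.\<close>

definition unipotent_radical :: "('b \<Rightarrow> 'b) set \<Rightarrow> ('b \<Rightarrow> 'b) set" where
  "unipotent_radical P =
    (GREATEST N. N \<lhd> GL\<lparr>carrier := P\<rparr> \<and>
       closedin (subtopology zariski (carrier GL)) N \<and>
       connectedin zariski N \<and>
       (\<forall>g \<in> N. unipotent g))"

text \<open>The Zariski tangent space at the identity: \<open>X\<close> belongs to it iff, for every regular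
  function \<open>p\<close> vanishing on \<open>N\<close>, the polynomial \<open>t \<mapsto> p (id + t X)\<close> has no linear term.
  That this is always a polynomial in \<open>t\<close> is the lemma after the definition; over an infinite
  field it is unique.\<close>

definition lie_algebra :: "('b \<Rightarrow> 'b) set \<Rightarrow> ('b \<Rightarrow> 'b) set" where
  "lie_algebra N = {X \<in> gl. \<forall>p \<in> regular. (\<forall>g \<in> N. p g = 0) \<longrightarrow>
     (\<exists>q. (\<forall>t. poly q t = p (\<lambda>v. v + scale t (X v))) \<and> poly (pderiv q) 0 = 0)}"

lemma regular_along_line:
  assumes "p \<in> regular"
  shows "\<exists>q. \<forall>t. poly q t = p (\<lambda>v. v + scale t (X v))"
  using assms
proof induction
  case (const c)
  show ?case by (rule exI[of _ "[:c:]"]) simp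
next
  case (coeff \<phi> v)
  interpret \<phi>: Vector_Spaces.linear scale "(*)" \<phi> by (fact coeff)
  show ?case
    by (rule exI[of _ "[:\<phi> v, \<phi> (X v):]"]) (simp add: \<phi>.add \<phi>.scale)
next
  case (add p q)
  then show ?case by (metis poly_add)
next
  case (mult p q)
  then show ?case by (metis poly_mult)
qed


subsection \<open>Richardson orbits and nil-equivalence\<close>

definition Ad :: "('b \<Rightarrow> 'b) \<Rightarrow> ('b \<Rightarrow> 'b) \<Rightarrow> ('b \<Rightarrow> 'b)" where
  "Ad g X = g \<circ> X \<circ> inv\<^bsub>GL\<^esub> g"

text \<open>The open orbit \<open>O\<^sub>P\<close> of \<open>P\<close> in the Lie algebra of its unipotent radical.\<close>

definition richardson_orbit :: "('b \<Rightarrow> 'b) set \<Rightarrow> ('b \<Rightarrow> 'b) set" where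
  "richardson_orbit P =
    (let \<nn> = lie_algebra (unipotent_radical P) in
      THE \<O>. (\<exists>X \<in> \<nn>. \<O> = {Ad g X | g. g \<in> P}) \<and> openin (subtopology zariski \<nn>) \<O>)"

text \<open>The group acts on tuples of subspaces componentwise.\<close>

definition stabilizer :: "'b set list \<Rightarrow> ('b \<Rightarrow> 'b) set" where
  "stabilizer F = {g \<in> carrier GL. map (image g) F = F}"

text \<open>\<open>\<N> X = G \<cdot> O\<^sub>P\<close> for a variety \<open>X \<cong> G/P\<close> of flags. The stabilizers of the points of the
  homogeneous space \<open>X\<close> are conjugate and each of them contributes the same \<open>G \<cdot> O\<^sub>P\<close>; taking
  the union over all points avoids choosing a base point.\<close>

definition nil_variety :: "'b set list set \<Rightarrow> ('b \<Rightarrow> 'b) set" where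
  "nil_variety \<X> =
    (\<Union>F \<in> \<X>. {Ad g Y | g Y. g \<in> carrier GL \<and> Y \<in> richardson_orbit (stabilizer F)})"

definition nil_equivalent :: "'b set list set \<Rightarrow> 'b set list set \<Rightarrow> bool" where
  "nil_equivalent \<X> \<Y> \<longleftrightarrow> nil_variety \<X> = nil_variety \<Y>"

text \<open>Flags \<open>F = [V\<^sub>1, \<dots>, V\<^sub>s]\<close>; prefixing \<open>V\<^sub>0 = {0}\<close> makes \<open>({0} # F) ! i\<close> equal to \<open>V\<^sub>i\<close>
  for \<open>i \<le> s\<close>. Entry \<open>i\<close> of the list \<open>a\<close> is the dimension of \<open>V\<^bsub>i+1\<^esub> / V\<^sub>i\<close>.\<close>

definition Fl :: "nat list \<Rightarrow> 'b set list set" where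
  "Fl a = {F. length F = length a \<and> (\<forall>W \<in> set F. subspace W) \<and> last ({0} # F) = UNIV \<and>
     (\<forall>i < length a. ({0} # F) ! i \<subseteq> ({0} # F) ! Suc i \<and>
        dim (({0} # F) ! Suc i) = dim (({0} # F) ! i) + a ! i)}"

end

end

theory Submission
  imports Defs
begin

text \<open>For a flag with stabilizer \<open>P\<close>, the unipotent radical consists of the \<open>g\<close> for which \<open>g - 1\<close>
  maps every \<open>V\<^bsub>i+1\<^esub>\<close> into \<open>V\<^sub>i\<close>, and its Lie algebra \<open>\<nn>\<close> consists of the endomorphisms with
  this property. For \<open>X \<in> \<nn>\<close>, the ranks of the powers of \<open>X\<close> are at most those of a nilpotent
  endomorphism whose Jordan type is conjugate to the composition \<open>a\<close>, and equality is possible.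
  An \<open>X\<close> attaining them lowers no other flag of type \<open>a\<close>. Hence an element of \<open>GL\<close> conjugating
  two such endomorphisms of \<open>\<nn>\<close> lies in \<open>P\<close>; they form a single \<open>P\<close>-orbit, which is open
  because ranks are lower semicontinuous, and it is the only open orbit because \<open>\<nn>\<close> is
  irreducible. So \<open>\<N>(Fl a)\<close> is the set of nilpotent endomorphisms of Jordan type conjugate to
  \<open>a\<close>, which determines \<open>a\<close> exactly up to the order of its entries.\<close>

section \<open>Conjugate partitions\<close>

text \<open>The numbers dim X^k V take the place of the Jordan normal form, and no dimensions of
  orbits or centralizers are computed. The obstacle is that the entries of \<open>a\<close> come in
  any order, while Jordan blocks are sorted by size. All inductions therefore remove the last entry
  \<open>c\<close>, and the number \<open>r\<close> of earlier entries that are at least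
  \<open>c\<close> governs them. If W in U is the last step of the flag, there are two crude
  estimates: X^k U exceeds X^k W by at most \<open>c\<close> dimensions, and X^(k+1) U lies in X^k
  W. The first yields the rank bound for exponents up to \<open>r\<close>, the second for exponents
  above \<open>r\<close>; the sorted partition appears without any sorting. If all ranks are
  maximal, both bounds are attained around the exponent \<open>r\<close>, and this rigidity is what
  makes the flag recoverable from X.\<close>

definition conj_part :: "nat list \<Rightarrow> nat \<Rightarrow> nat" where
  "conj_part a j = length (filter (\<lambda>x. j < x) a)"

text \<open>The rank of the \<open>k\<close>-th power of a nilpotent endomorphism with Jordan blocks of sizes
  \<open>conj_part a 0, \<dots>, conj_part a (M - 1)\<close>.\<close>

definition richardson_rank :: "nat \<Rightarrow> nat list \<Rightarrow> nat \<Rightarrow> nat" where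
  "richardson_rank M a k = (\<Sum>j<M. conj_part a j - k)"

lemma conj_part_Nil [simp]: "conj_part [] j = 0"
  by (simp add: conj_part_def)

lemma conj_part_snoc: "conj_part (a @ [c]) j = conj_part a j + (if j < c then 1 else 0)"
  by (simp add: conj_part_def)

lemma conj_part_antimono: "i \<le> j \<Longrightarrow> conj_part a j \<le> conj_part a i"
  by (induction a) (auto simp: conj_part_def)

lemma conj_part_mset: "conj_part a j = size (filter_mset (\<lambda>x. j < x) (mset a))"
  by (simp add: conj_part_def flip: mset_filter)

lemma conj_part_eq_0: "\<forall>x\<in>set a. x \<le> j \<Longrightarrow> conj_part a j = 0"
  by (auto simp: conj_part_def filter_empty_conv)

lemma conj_part_le_length: "conj_part a j \<le> length a"
  by (simp add: conj_part_def)

lemma richardson_rank_Nil [simp]: "richardson_rank M [] k = 0"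
  by (simp add: richardson_rank_def)

lemma richardson_rank_large: "length a \<le> k \<Longrightarrow> richardson_rank M a k = 0"
  using conj_part_le_length[of a] by (force simp: richardson_rank_def intro: order.trans)

text \<open>Appending \<open>c\<close> lengthens the first \<open>c\<close> blocks by one. All of
  these already have size at least \<open>k\<close>, so the truncated subtraction loses nothing and
  each contributes one more.\<close>

lemma richardson_rank_snoc_le:
  assumes "k \<le> length (filter (\<lambda>x. c \<le> x) a)" "c \<le> M"
  shows "richardson_rank M (a @ [c]) k = richardson_rank M a k + c"
proof -
  have "k \<le> conj_part a j" if "j < c" for j
  proof -
    have "length (filter (\<lambda>x. c \<le> x) a) \<le> conj_part a j"
      using that by (induction a) (auto simp: conj_part_def)
    then show ?thesis using assms by simp
  qed
  then have "richardson_rank M (a @ [c]) k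
      = (\<Sum>j<M. (conj_part a j - k) + (if j < c then 1 else 0))"
    unfolding richardson_rank_def by (intro sum.cong) (auto simp: conj_part_snoc Suc_diff_le)
  also have "\<dots> = richardson_rank M a k + (\<Sum>j<M. if j < c then 1 else 0)"
    by (simp add: sum.distrib richardson_rank_def)
  also have "(\<Sum>j<M. if j < c then 1 else 0 :: nat) = card ({..<M} \<inter> {j. j < c})"
    by (simp add: sum.If_cases)
  also have "{..<M} \<inter> {j. j < c} = {..<c}" using assms by auto
  finally show ?thesis by simp
qed

text \<open>The blocks with index below \<open>c\<close> grow by one together with the exponent; the
  others have size at most \<open>k\<close> and contribute 0 on both sides.\<close>

lemma richardson_rank_snoc_ge:
  assumes "length (filter (\<lambda>x. c \<le> x) a) \<le> k"
  shows "richardson_rank M (a @ [c]) (Suc k) = richardson_rank M a k"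
  unfolding richardson_rank_def
proof (intro sum.cong refl)
  fix j
  have "conj_part a j \<le> length (filter (\<lambda>x. c \<le> x) a)" if "c \<le> j"
    using that by (induction a) (auto simp: conj_part_def)
  then show "conj_part (a @ [c]) j - Suc k = conj_part a j - k"
    using assms by (auto simp: conj_part_snoc)
qed

text \<open>The difference of consecutive ranks counts the blocks of size greater than
  \<open>k\<close>. Sizes decrease with the index, so these blocks form an initial segment, and the
  rank function determines every block size.\<close>

lemma less_conj_part_iff:
  assumes "\<forall>x\<in>set a. x \<le> M" "j < M"
  shows "k < conj_part a j \<longleftrightarrow> j < richardson_rank M a k - richardson_rank M a (Suc k)"
proof -
  have "richardson_rank M a k = (\<Sum>j<M. (conj_part a j - Suc k) + (if k < conj_part a j then 1 else 0))"
    unfolding richardson_rank_def by (intro sum.cong) auto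
  also have "\<dots> = richardson_rank M a (Suc k) + card {j. j < M \<and> k < conj_part a j}"
    by (simp add: sum.distrib richardson_rank_def sum.If_cases Int_def)
  finally have card: "richardson_rank M a k - richardson_rank M a (Suc k)
      = card {j. j < M \<and> k < conj_part a j}" by simp
  show ?thesis
  proof
    assume "k < conj_part a j"
    then have "{..j} \<subseteq> {j. j < M \<and> k < conj_part a j}"
      using assms conj_part_antimono[of _ j a] by (force intro: less_le_trans)
    then have "card {..j} \<le> card {j. j < M \<and> k < conj_part a j}" by (intro card_mono) auto
    then show "j < richardson_rank M a k - richardson_rank M a (Suc k)" by (simp add: card)
  next
    assume *: "j < richardson_rank M a k - richardson_rank M a (Suc k)"
    show "k < conj_part a j"
    proof (rule ccontr)
      assume "\<not> k < conj_part a j"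
      then have "{j. j < M \<and> k < conj_part a j} \<subseteq> {..<j}"
        using conj_part_antimono[of j _ a] by (auto simp: not_less) (meson leD le_trans not_le_imp_less)
      then have "card {j. j < M \<and> k < conj_part a j} \<le> card {..<j}" by (intro card_mono) auto
      then show False using * by (simp add: card)
    qed
  qed
qed

lemma richardson_rank_eq_iff:
  assumes a: "\<forall>x\<in>set a. 0 < x \<and> x \<le> M" and b: "\<forall>x\<in>set b. 0 < x \<and> x \<le> M"
  shows "richardson_rank M a = richardson_rank M b \<longleftrightarrow> mset a = mset b"
proof
  assume eq: "richardson_rank M a = richardson_rank M b"
  have conj: "conj_part a j = conj_part b j" for j
  proof (cases "j < M")
    case True
    then have "k < conj_part a j \<longleftrightarrow> k < conj_part b j" for k
      using a b less_conj_part_iff[of a M j k] less_conj_part_iff[of b M j k] eq by simp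
    then show ?thesis by (meson less_irrefl linorder_less_linear)
  next
    case False
    then show ?thesis using a b conj_part_eq_0[of a j] conj_part_eq_0[of b j] by fastforce
  qed
  \<comment> \<open>Consecutive block sizes differ by the multiplicity of \<open>Suc j\<close>. The
    multiplicity of 0 is invisible to \<open>conj_part\<close>; positivity of the entries settles
    it.\<close>
  have count: "count (mset l) (Suc j) + conj_part l (Suc j) = conj_part l j" for l j
    by (induction l) (auto simp: conj_part_def)
  show "mset a = mset b"
  proof (rule multiset_eqI)
    fix x
    show "count (mset a) x = count (mset b) x"
    proof (cases x)
      case 0
      then show ?thesis using a b by (metis count_eq_zero_iff less_irrefl set_mset_mset)
    next
      case (Suc j)
      then show ?thesis using count[of a j] count[of b j] by (simp add: conj)
    qed
  qed
next
  assume "mset a = mset b"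
  then show "richardson_rank M a = richardson_rank M b"
    by (intro ext) (simp add: richardson_rank_def conj_part_mset)
qed

section \<open>Endomorphisms and subspaces\<close>

locale fin_linear_group = linear_group scale + finite_dimensional_vector_space scale Basis
  for scale :: "'k::field_char_0 \<Rightarrow> 'v::ab_group_add \<Rightarrow> 'v"
    and Basis :: "'v set"
begin

sublocale endo: finite_dimensional_vector_space_pair scale Basis scale Basis
  by unfold_locales

sublocale form: vector_space_pair scale "(*) :: 'k \<Rightarrow> 'k \<Rightarrow> 'k"
  by unfold_locales (auto simp: algebra_simps)

lemma gl_add: "X \<in> gl \<Longrightarrow> X (u + v) = X u + X v"
  and gl_diff: "X \<in> gl \<Longrightarrow> X (u - v) = X u - X v"
  and gl_scale: "X \<in> gl \<Longrightarrow> X (scale c v) = scale c (X v)"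
  and gl_0 [simp]: "X \<in> gl \<Longrightarrow> X 0 = 0"
  and gl_sum: "X \<in> gl \<Longrightarrow> X (sum f I) = (\<Sum>i\<in>I. X (f i))"
  by (simp_all add: gl_def endo.linear_add endo.linear_diff endo.linear_scale endo.linear_0
      endo.linear_sum)

lemma glI: "(\<And>u v. X (u + v) = X u + X v) \<Longrightarrow> (\<And>c v. X (scale c v) = scale c (X v)) \<Longrightarrow> X \<in> gl"
  unfolding gl_def by (simp add: Vector_Spaces.linear_iff vector_space_axioms)

lemma gl_id [simp]: "id \<in> gl" "(\<lambda>v. v) \<in> gl"
  by (auto intro: glI)

lemma gl_comp: "X \<in> gl \<Longrightarrow> Y \<in> gl \<Longrightarrow> X \<circ> Y \<in> gl"
  by (rule glI) (simp_all add: gl_add gl_scale)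

lemma gl_funpow: "X \<in> gl \<Longrightarrow> X ^^ k \<in> gl"
  by (induction k) (auto simp: gl_comp)

lemma subspace_image_gl: "X \<in> gl \<Longrightarrow> subspace U \<Longrightarrow> subspace (X ` U)"
  by (simp add: gl_def endo.linear_subspace_image)

lemma dim_image_gl_eq: "X \<in> gl \<Longrightarrow> subspace U \<Longrightarrow> inj_on X U \<Longrightarrow> dim (X ` U) = dim U"
  using endo.dim_image_eq[of X U] by (simp add: gl_def span_eq_iff[THEN iffD2])

lemma subspace_kernel_gl: "X \<in> gl \<Longrightarrow> subspace U \<Longrightarrow> subspace {u \<in> U. X u = 0}"
  by (auto simp: subspace_def gl_add gl_scale)

text \<open>A linear section \<open>g\<close> of \<open>X\<close> over the image of
  \<open>U\<close>, with values in \<open>U\<close>, splits \<open>U\<close> into the image of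
  \<open>g\<close> and the kernel.\<close>

lemma rank_nullity:
  assumes X: "X \<in> gl" and U: "subspace U"
  shows "dim U = dim (X ` U) + dim {u \<in> U. X u = 0}"
proof -
  obtain g where g: "g ` UNIV \<subseteq> U" "g \<in> gl" "\<forall>v\<in>X ` U. X (g v) = v"
    using endo.linear_exists_right_inverse_on[of X U] X U unfolding gl_def by auto
  let ?C = "g ` X ` U" and ?K = "{u \<in> U. X u = 0}"
  have C: "subspace ?C" using g X U by (intro subspace_image_gl)
  have K: "subspace ?K" using X U by (rule subspace_kernel_gl)
  have "inj_on g (X ` U)" by (metis g(3) inj_onI)
  then have dimC: "dim ?C = dim (X ` U)" using g X U by (intro dim_image_gl_eq subspace_image_gl)
  have "{x + y |x y. x \<in> ?C \<and> y \<in> ?K} = U"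
  proof (intro subset_antisym subsetI)
    fix u assume "u \<in> {x + y |x y. x \<in> ?C \<and> y \<in> ?K}"
    then show "u \<in> U" using g(1) U by (auto intro!: subspace_add)
  next
    fix u assume u: "u \<in> U"
    have "u = g (X u) + (u - g (X u))" by simp
    moreover have "u - g (X u) \<in> ?K" using u g X U by (auto intro!: subspace_diff simp: gl_diff)
    ultimately show "u \<in> {x + y |x y. x \<in> ?C \<and> y \<in> ?K}" using u by blast
  qed
  moreover have "dim (?C \<inter> ?K) = 0"
    using g by (auto simp: dim_eq_0)
  ultimately show ?thesis using dim_sums_Int[OF C K] dimC by (metis add.right_neutral)
qed

lemma dim_image_le_add:
  assumes X: "X \<in> gl" and "subspace U" "subspace W" "W \<subseteq> U" "dim U = dim W + c"
  shows "dim (X ` U) \<le> dim (X ` W) + c"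
proof -
  have "dim {u \<in> W. X u = 0} \<le> dim {u \<in> U. X u = 0}" using assms by (intro dim_subset) auto
  then show ?thesis using rank_nullity[of X U] rank_nullity[of X W] assms by simp
qed

lemma extend_basis_subspace:
  assumes "subspace U" "independent B" "B \<subseteq> U"
  obtains C where "B \<subseteq> C" "independent C" "span C = U"
  by (metis assms maximal_independent_subset_extend span_subspace)

lemma extend_to_gl:
  assumes "independent B"
  obtains X where "X \<in> gl" "\<forall>b\<in>B. X b = f b"
  using endo.linear_independent_extend[OF assms, of f] by (auto simp: gl_def)

lemma span_induct_gl:
  assumes X: "X \<in> gl" and W: "subspace W" and "\<And>b. b \<in> B \<Longrightarrow> X b \<in> W" "v \<in> span B"
  shows "X v \<in> W"
  using \<open>v \<in> span B\<close>
proof (induction rule: span_induct)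
  case base
  show ?case using W X by (auto simp: subspace_def gl_add gl_scale)
qed (use assms in auto)

lemma subspace_complement:
  assumes S: "subspace S" and U: "subspace U" and "S \<subseteq> U"
  obtains T where "subspace T" "S \<inter> T = {0}" "U = {x + y |x y. x \<in> S \<and> y \<in> T}"
proof -
  obtain B where B: "B \<subseteq> S" "independent B" "span B = S"
    using basis_subspace_exists[OF S] by metis
  obtain C where C: "B \<subseteq> C" "independent C" "span C = U"
    using extend_basis_subspace[OF U B(2)] B(1) \<open>S \<subseteq> U\<close> by auto
  let ?T = "span (C - B)"
  have sum: "U = {x + y |x y. x \<in> S \<and> y \<in> ?T}"
    using span_Un[of B "C - B"] B C by (simp add: Un_absorb1)
  have "card C = card B + card (C - B)"
    using C finiteI_independent[OF C(2)]
    by (metis B(2) card_Diff_subset card_mono finiteI_independent le_add_diff_inverse)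
  moreover have "dim U = card C" "dim S = card B" "dim ?T = card (C - B)"
    using B C independent_mono[OF C(2), of "C - B"] dim_span_eq_card_independent by auto
  ultimately have "dim (S \<inter> ?T) = 0"
    using dim_sums_Int[OF S subspace_span, of "C - B"] sum by simp
  then have "S \<inter> ?T = {0}"
    using subspace_0[OF S] span_zero by (auto simp only: dim_eq_0)
  then show thesis using sum that[of ?T] by simp
qed

lemma glue_gl:
  assumes S: "subspace S" and T: "subspace T" and ST: "S \<inter> T = {0}" and "g \<in> gl" "h \<in> gl"
  obtains k where "k \<in> gl" "\<forall>s\<in>S. k s = g s" "\<forall>t\<in>T. k t = h t"
proof -
  obtain B where B: "finite B" "B \<subseteq> S" "independent B" "span B = S" "card B = dim S"
    using basis_subspace_exists[OF S] by metis
  obtain C where C: "finite C" "C \<subseteq> T" "independent C" "span C = T" "card C = dim T"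
    using basis_subspace_exists[OF T] by metis
  have "dim (S \<inter> T) = 0" unfolding ST by simp
  then have "dim (span (B \<union> C)) = card B + card C"
    using dim_sums_Int[OF S T] B C span_Un[of B C] by (simp del: dim_eq_0)
  moreover have "card (B \<union> C) \<le> card B + card C" by (rule card_Un_le)
  ultimately have "independent (B \<union> C)"
    using B C by (intro card_le_dim_spanning[of _ "span (B \<union> C)"]) (auto simp: span_base)
  then obtain k where k: "k \<in> gl" "\<forall>b\<in>B \<union> C. k b = (if b \<in> S then g b else h b)"
    by (rule extend_to_gl)
  have "k b = g b" if "b \<in> B" for b
    using k that B(2) by auto
  then have "k s = g s" if "s \<in> S" for s
    using endo.linear_eq_on_span[of k g B] k B that assms by (auto simp: gl_def)
  \<comment> \<open>The rule for \<open>k\<close> selects by membership in \<open>S\<close>; a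
    vector of \<open>C\<close> inside \<open>S\<close> can only be 0, where \<open>k\<close> and
    \<open>h\<close> agree.\<close>
  moreover have "k c = h c" if "c \<in> C" for c
  proof (cases "c \<in> S")
    case True
    then have "c = 0" using that C ST by auto
    then show ?thesis using k assms by simp
  qed (use k that in auto)
  then have "k t = h t" if "t \<in> T" for t
    using endo.linear_eq_on_span[of k h C] k C that assms by (auto simp: gl_def)
  ultimately show thesis using k that by blast
qed

lemma inj_on_gl_iff: "X \<in> gl \<Longrightarrow> subspace U \<Longrightarrow> inj_on X U \<longleftrightarrow> (\<forall>u\<in>U. X u = 0 \<longrightarrow> u = 0)"
  unfolding gl_def using endo.linear_inj_on_iff_eq_0 by auto

lemma image_funpow_Suc: "(f ^^ k) ` f ` A = (f ^^ Suc k) ` A"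
  by (simp add: funpow_Suc_right image_comp del: funpow.simps)

section \<open>Nilpotent endomorphisms with equal ranks of powers are conjugate\<close>

text \<open>The induction descends from U to X U, hence the formulation for invariant subspaces. To
  extend \<open>g\<close> from X U to U, write U as the direct sum of X U, a complement D of ker X
  \<inter> X U in ker X, and a remainder E. Then D goes isomorphically to its counterpart D', and z
  in E goes to a preimage under Y of g (X z).\<close>

lemma nilpotent_conjugate:
  assumes X: "X \<in> gl" and Y: "Y \<in> gl"
  shows "subspace U \<Longrightarrow> subspace U' \<Longrightarrow> X ` U \<subseteq> U \<Longrightarrow> Y ` U' \<subseteq> U' \<Longrightarrow>
    (\<And>k. dim ((X ^^ k) ` U) = dim ((Y ^^ k) ` U')) \<Longrightarrow> (X ^^ n) ` U \<subseteq> {0} \<Longrightarrow>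
    \<exists>g\<in>gl. inj_on g U \<and> g ` U = U' \<and> (\<forall>u\<in>U. g (X u) = Y (g u))"
proof (induction n arbitrary: U U')
  case 0
  then have "U = {0}" using subspace_0[OF 0(1)] by auto
  moreover have "dim U' = 0" using 0(5)[of 0] \<open>U = {0}\<close> by simp
  then have "U' = {0}" using subspace_0[OF 0(2)] by (auto simp only: dim_eq_0)
  ultimately show ?case using X Y by (intro bexI[of _ id]) auto
next
  case (Suc n)
  note U = \<open>subspace U\<close> and U' = \<open>subspace U'\<close>
  define U1 U1' where "U1 = X ` U" and "U1' = Y ` U'"
  define K K' where "K = {u \<in> U. X u = 0}" and "K' = {u \<in> U'. Y u = 0}"
  have U1: "subspace U1" "U1 \<subseteq> U" and U1': "subspace U1'" "U1' \<subseteq> U'"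
    using Suc.prems X Y by (auto simp: U1_def U1'_def intro!: subspace_image_gl)
  have K: "subspace K" and K': "subspace K'"
    unfolding K_def K'_def using X Y U U' by (auto intro: subspace_kernel_gl)
  have K1: "subspace (K \<inter> U1)" and K1': "subspace (K' \<inter> U1')"
    using K K' U1 U1' by (auto intro: subspace_inter)
  have ranks: "dim ((X ^^ k) ` U1) = dim ((Y ^^ k) ` U1')" for k
    using Suc.prems(5)[of "Suc k"] by (simp only: image_funpow_Suc U1_def U1'_def)
  obtain g where g: "g \<in> gl" "inj_on g U1" "g ` U1 = U1'" "\<And>u. u \<in> U1 \<Longrightarrow> g (X u) = Y (g u)"
  proof -
    have "X ` U1 \<subseteq> U1" "Y ` U1' \<subseteq> U1'" using U1 U1' by (auto simp: U1_def U1'_def)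
    moreover have "(X ^^ n) ` U1 \<subseteq> {0}"
      using Suc.prems(6) by (simp only: image_funpow_Suc U1_def)
    ultimately show thesis using Suc.IH[OF U1(1) U1'(1) _ _ ranks] that by blast
  qed
  obtain D where D: "subspace D" "(K \<inter> U1) \<inter> D = {0}" "K = {x + y |x y. x \<in> K \<inter> U1 \<and> y \<in> D}"
    using subspace_complement[OF K1 K] by blast
  obtain D' where D': "subspace D'" "(K' \<inter> U1') \<inter> D' = {0}" "K' = {x + y |x y. x \<in> K' \<inter> U1' \<and> y \<in> D'}"
    using subspace_complement[OF K1' K'] by blast
  have DK: "D \<subseteq> K"
    using D(3) subspace_0[OF K1] by (metis (mono_tags, lifting) add.left_neutral mem_Collect_eq subsetI)
  have DK': "D' \<subseteq> K'"
    using D'(3) subspace_0[OF K1'] by (metis (mono_tags, lifting) add.left_neutral mem_Collect_eq subsetI)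
  \<comment> \<open>\<open>D\<close> accounts for the Jordan blocks of size 1: its dimension is dim
    U - 2 dim X U + dim X^2 U, an expression in the ranks alone.\<close>
  have "dim D = dim D'"
  proof -
    have "{u \<in> U1. X u = 0} = K \<inter> U1" "{u \<in> U1'. Y u = 0} = K' \<inter> U1'"
      using U1 U1' by (auto simp: K_def K'_def)
    then have "dim U1 = dim (X ` U1) + dim (K \<inter> U1)" "dim U1' = dim (Y ` U1') + dim (K' \<inter> U1')"
      using rank_nullity[OF X U1(1)] rank_nullity[OF Y U1'(1)] by simp_all
    moreover have "dim U = dim U1 + dim K" "dim U' = dim U1' + dim K'"
      using rank_nullity[OF X U] rank_nullity[OF Y U'] by (simp_all add: U1_def U1'_def K_def K'_def)
    moreover have "dim U = dim U'" using Suc.prems(5)[of 0] by simp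
    moreover have "dim U1 = dim U1'" "dim (X ` U1) = dim (Y ` U1')"
      using ranks[of 0] ranks[of 1] by simp_all
    moreover have "dim K + dim {0} = dim (K \<inter> U1) + dim D" "dim K' + dim {0} = dim (K' \<inter> U1') + dim D'"
      using dim_sums_Int[OF K1 D(1)] dim_sums_Int[OF K1' D'(1)] D D' by metis+
    ultimately show ?thesis by linarith
  qed
  then obtain h where h: "h \<in> gl" "h ` D = D'" "inj_on h D"
    using endo.subspace_isomorphism[OF D(1) D'(1)] by (auto simp: gl_def)
  obtain q where q: "range q \<subseteq> U'" "q \<in> gl" "\<And>w. w \<in> U1' \<Longrightarrow> Y (q w) = w"
    using endo.linear_exists_right_inverse_on[of Y U'] Y U' by (auto simp: U1'_def gl_def)
  have "U1 \<inter> D = {0}" using D(2) DK by blast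
  then obtain k1 where k1: "k1 \<in> gl" "\<forall>u\<in>U1. k1 u = g u" "\<forall>u\<in>D. k1 u = h u"
    by (rule glue_gl[OF U1(1) D(1) _ g(1) h(1)])
  define S where "S = {x + y |x y. x \<in> U1 \<and> y \<in> D}"
  have S: "subspace S" unfolding S_def by (rule subspace_sums[OF U1(1) D(1)])
  have SU: "S \<subseteq> U"
  proof
    fix u assume "u \<in> S"
    then obtain x y where "u = x + y" "x \<in> U" "y \<in> U" using U1 DK by (auto simp: S_def K_def)
    then show "u \<in> U" using subspace_add[OF U] by simp
  qed
  obtain E where E: "subspace E" "S \<inter> E = {0}" "U = {x + y |x y. x \<in> S \<and> y \<in> E}"
    using subspace_complement[OF S U SU] by blast
  have EU: "E \<subseteq> U"
    using E(3) subspace_0[OF S] by (metis (mono_tags, lifting) add.left_neutral mem_Collect_eq subsetI)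
  have "q \<circ> g \<circ> X \<in> gl" using q g X by (intro gl_comp)
  then obtain k where k: "k \<in> gl" "\<forall>u\<in>S. k u = k1 u" "\<forall>u\<in>E. k u = (q \<circ> g \<circ> X) u"
    by (rule glue_gl[OF S E(1,2) k1(1)])
  have S': "u \<in> S" if "u \<in> U1 \<or> u \<in> D" for u
    using that subspace_0[OF U1(1)] subspace_0[OF D(1)] unfolding S_def
    by (metis (mono_tags, lifting) add.left_neutral add.right_neutral mem_Collect_eq)
  have kU1: "k u = g u" if "u \<in> U1" for u using that k k1 S' by simp
  have kD: "k u = h u" if "u \<in> D" for u using that k k1 S' by simp
  have decomp: "\<exists>x y z. u = x + y + z \<and> x \<in> U1 \<and> y \<in> D \<and> z \<in> E" if "u \<in> U" for u
    using that E(3) unfolding S_def by auto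
  have intertw: "k (X u) = Y (k u) \<and> k u \<in> U'" if "u \<in> U" for u
  proof -
    obtain x y z where u: "u = x + y + z" "x \<in> U1" "y \<in> D" "z \<in> E" using decomp \<open>u \<in> U\<close> by blast
    have "X y = 0" using u DK by (auto simp: K_def)
    have Xx: "X x \<in> U1" "X z \<in> U1" using u U1(2) EU by (auto simp: U1_def)
    have hy: "h y \<in> D'" using h u by auto
    then have "Y (h y) = 0" using DK' by (auto simp: K'_def)
    moreover have "Y (q (g (X z))) = g (X z)" using q(3) g(3) Xx by blast
    ultimately have "Y (k u) = g (X x) + g (X z)"
      using u k kU1 kD Y g(4) by (simp add: gl_add)
    moreover have "k (X u) = g (X x) + g (X z)"
      using u k(1) kU1 Xx X \<open>X y = 0\<close> by (simp add: gl_add)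
    moreover have "k u = g x + h y + q (g (X z))" using u k kU1 kD by (simp add: gl_add)
    moreover have "g x \<in> U'" "h y \<in> U'" "q (g (X z)) \<in> U'"
      using u g(3) U1' hy DK' q by (auto simp: K'_def)
    ultimately show ?thesis using U' by (auto intro: subspace_add)
  qed
  \<comment> \<open>If k u = 0, then g (X u) = Y (k u) = 0, so u lies in ker X and splits into x in
    \<open>K \<inter> U1\<close> and y in \<open>D\<close>. Their images lie in
    \<open>K' \<inter> U1'\<close> and \<open>D'\<close>, which meet only in 0.\<close>
  have ker: "u = 0" if "u \<in> U" "k u = 0" for u
  proof -
    have Xu: "X u \<in> U1" using that by (auto simp: U1_def)
    have "g (X u) = 0" using intertw[OF that(1)] that kU1[OF Xu] Y by simp
    then have "X u = 0" using Xu g(1,2) inj_on_gl_iff[OF g(1) U1(1)] by blast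
    then have "u \<in> K" using that by (simp add: K_def)
    then obtain x y where u: "u = x + y" "x \<in> K" "x \<in> U1" "y \<in> D" using D(3) by blast
    have "g x \<in> U1'" using u g by auto
    moreover have "Y (g x) = 0" using g(1) g(4)[of x] u by (simp add: K_def)
    ultimately have "g x \<in> K' \<inter> U1'" using U1' by (auto simp: K'_def)
    have "g x + h y = 0" using that u k(1) kU1 kD by (simp add: gl_add)
    then have "h y = - g x" by (simp add: add_eq_0_iff)
    then have "h y \<in> K' \<inter> U1'" using K1' \<open>g x \<in> K' \<inter> U1'\<close> by (metis subspace_neg)
    moreover have "h y \<in> D'" using h u by auto
    ultimately have "h y = 0" using D'(2) by blast
    then have "g x = 0" using \<open>h y = - g x\<close> by simp
    have "y = 0" using \<open>h y = 0\<close> u h inj_on_gl_iff[OF h(1) D(1)] by blast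
    moreover have "x = 0" using \<open>g x = 0\<close> u g inj_on_gl_iff[OF g(1) U1(1)] by blast
    ultimately show ?thesis using u by simp
  qed
  then have inj: "inj_on k U" using inj_on_gl_iff[OF k(1) U] by blast
  have "dim (k ` U) = dim U'"
    using dim_image_gl_eq[OF k(1) U inj] Suc.prems(5)[of 0] by simp
  then have "k ` U = U'"
    using intertw k U U' by (intro subspace_dim_equal subspace_image_gl) auto
  then show ?case using k inj intertw by blast
qed

section \<open>Filtrations and the endomorphisms that lower them\<close>

text \<open>The top member need not be the whole space, and nothing is demanded beyond index
  \<open>length a\<close>. So the same \<open>V\<close> is a filtration for every prefix of
  \<open>a\<close>, as induction from the right requires.\<close>

definition filtration :: "nat list \<Rightarrow> (nat \<Rightarrow> 'v set) \<Rightarrow> bool" where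
  "filtration a V \<longleftrightarrow> V 0 = {0} \<and> (\<forall>i<length a. subspace (V (Suc i)) \<and> V i \<subseteq> V (Suc i) \<and>
     dim (V (Suc i)) = dim (V i) + a ! i)"

definition lowering :: "nat \<Rightarrow> (nat \<Rightarrow> 'v set) \<Rightarrow> ('v \<Rightarrow> 'v) set" where
  "lowering s V = {X \<in> gl. \<forall>i<s. X ` V (Suc i) \<subseteq> V i}"

lemma filtration_snoc:
  "filtration (a @ [c]) V \<longleftrightarrow> filtration a V \<and> subspace (V (Suc (length a))) \<and>
     V (length a) \<subseteq> V (Suc (length a)) \<and> dim (V (Suc (length a))) = dim (V (length a)) + c"
  by (auto simp: filtration_def nth_append less_Suc_eq)

lemma loweringD: "X \<in> lowering s V \<Longrightarrow> i < s \<Longrightarrow> v \<in> V (Suc i) \<Longrightarrow> X v \<in> V i"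
  by (auto simp: lowering_def)

lemma lowering_Suc: "X \<in> lowering (Suc s) V \<longleftrightarrow> X \<in> lowering s V \<and> X ` V (Suc s) \<subseteq> V s"
  by (simp add: lowering_def All_less_Suc conj_ac)

lemma filtration_subspace: "filtration a V \<Longrightarrow> i \<le> length a \<Longrightarrow> subspace (V i)"
  by (cases i) (auto simp: filtration_def subspace_def)

lemma filtration_mono: "filtration a V \<Longrightarrow> i \<le> j \<Longrightarrow> j \<le> length a \<Longrightarrow> V i \<subseteq> V j"
proof (induction j)
  case (Suc j)
  then have "V j \<subseteq> V (Suc j)" by (simp add: filtration_def)
  then show ?case using Suc by (cases "i = Suc j") auto
qed simp

lemma lowering_rank_le:
  assumes "filtration a V" "X \<in> lowering (length a) V" "\<forall>x\<in>set a. x \<le> M"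
  shows "dim ((X ^^ k) ` V (length a)) \<le> richardson_rank M a k"
  using assms
proof (induction a arbitrary: k rule: rev_induct)
  case Nil
  then show ?case using gl_0[OF gl_funpow] by (simp add: filtration_def lowering_def)
next
  case (snoc c a)
  have X: "X \<in> gl" and a: "filtration a V" "X \<in> lowering (length a) V" "\<forall>x\<in>set a. x \<le> M"
    using snoc.prems by (auto simp: filtration_snoc lowering_Suc lowering_def)
  let ?W = "V (length a)" and ?U = "V (Suc (length a))" and ?r = "length (filter (\<lambda>x. c \<le> x) a)"
  have W: "subspace ?W" "subspace ?U" "?W \<subseteq> ?U" "dim ?U = dim ?W + c"
    using snoc.prems filtration_subspace[OF a(1)] by (auto simp: filtration_snoc)
  \<comment> \<open>Up to \<open>?r\<close> the codimension \<open>c\<close> of \<open>?W\<close> in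
    \<open>?U\<close> gives the bound; beyond it, one factor \<open>X\<close> is spent on moving
    from \<open>?U\<close> into \<open>?W\<close>.\<close>
  consider "k \<le> ?r" | k' where "k = Suc k'" "?r \<le> k'" by (cases k) force+
  then show ?case
  proof cases
    case 1
    then show ?thesis
      using dim_image_le_add[OF gl_funpow[OF X] W(2,1,3,4), of k] snoc.IH[OF a, of k]
        richardson_rank_snoc_le[of k c a M] snoc.prems by simp
  next
    case 2
    have "X ` ?U \<subseteq> ?W" using snoc.prems by (simp add: lowering_Suc)
    then have "(X ^^ k) ` ?U \<subseteq> (X ^^ k') ` ?W"
      by (simp only: 2 flip: image_funpow_Suc) (rule image_mono)
    then have "dim ((X ^^ k) ` ?U) \<le> dim ((X ^^ k') ` ?W)" by (rule dim_subset)
    then show ?thesis using snoc.IH[OF a, of k'] richardson_rank_snoc_ge[OF 2(2)] 2(1) by simp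
  qed
qed

text \<open>Maximal ranks on the top member U force equality in the inclusion of X^(r+1) U in X^r W.
  So W lies in the set of u with X^r u in X^(r+1) U, whose codimension in U is the drop from the
  r-th to the next rank; this drop is \<open>c\<close>, the codimension of W. The description of W
  involves only X and U.\<close>

lemma filtration_top_step:
  assumes V: "filtration (a @ [c]) V" and X: "X \<in> lowering (Suc (length a)) V"
    and M: "\<forall>x\<in>set (a @ [c]). x \<le> M"
    and rk: "\<And>k. dim ((X ^^ k) ` V (Suc (length a))) = richardson_rank M (a @ [c]) k"
  defines "r \<equiv> length (filter (\<lambda>x. c \<le> x) a)"
  shows "V (length a) = {u \<in> V (Suc (length a)). (X ^^ r) u \<in> (X ^^ Suc r) ` V (Suc (length a))}"
    and "dim ((X ^^ k) ` V (length a)) = richardson_rank M a k"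
proof -
  let ?W = "V (length a)" and ?U = "V (Suc (length a))"
  have gl: "X \<in> gl" and a: "filtration a V" "X \<in> lowering (length a) V" "\<forall>x\<in>set a. x \<le> M"
    using assms by (auto simp: filtration_snoc lowering_Suc lowering_def)
  have W: "subspace ?W" "subspace ?U" "?W \<subseteq> ?U" "dim ?U = dim ?W + c" "X ` ?U \<subseteq> ?W"
    using assms filtration_subspace[OF a(1)] by (auto simp: filtration_snoc lowering_Suc)
  have le: "dim ((X ^^ k) ` ?W) \<le> richardson_rank M a k" for k
    using a by (rule lowering_rank_le)
  have "(X ^^ Suc r) ` ?U \<subseteq> (X ^^ r) ` ?W"
    using W(5) by (simp only: flip: image_funpow_Suc) (rule image_mono)
  then have r: "(X ^^ Suc r) ` ?U = (X ^^ r) ` ?W"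
    using le[of r] rk[of "Suc r"] richardson_rank_snoc_ge[of c a r M] W gl_funpow[OF gl]
      \<open>(X ^^ Suc r) ` ?U \<subseteq> (X ^^ r) ` ?W\<close>
    by (intro subspace_dim_equal subspace_image_gl) (simp_all add: r_def del: funpow.simps)
  let ?T = "{u \<in> ?U. (X ^^ r) u \<in> (X ^^ Suc r) ` ?U}"
  have "?W \<subseteq> ?T" using W(3) r by blast
  have T: "subspace ?T"
  proof -
    have "subspace ((X ^^ Suc r) ` ?U)" using gl W by (intro subspace_image_gl gl_funpow)
    then show ?thesis
      using W(2) gl_funpow[OF gl, of r] by (auto simp: subspace_def gl_add gl_scale)
  qed
  have "(X ^^ r) ` ?T = (X ^^ Suc r) ` ?U"
    using \<open>?W \<subseteq> ?T\<close> r by blast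
  moreover have "{u \<in> ?T. (X ^^ r) u = 0} = {u \<in> ?U. (X ^^ r) u = 0}"
    using subspace_0[OF subspace_image_gl[OF gl_funpow[OF gl] W(2)], of "Suc r"] by auto
  ultimately have "dim ?T = dim ((X ^^ Suc r) ` ?U) + dim {u \<in> ?U. (X ^^ r) u = 0}"
    using rank_nullity[OF gl_funpow[OF gl] T, of r] by simp
  moreover have "dim ?U = dim ((X ^^ r) ` ?U) + dim {u \<in> ?U. (X ^^ r) u = 0}"
    using rank_nullity[OF gl_funpow[OF gl] W(2), of r] .
  ultimately have "dim ?T = dim ?W"
    using rk[of r] rk[of "Suc r"] richardson_rank_snoc_ge[of c a r M]
      richardson_rank_snoc_le[of r c a M] W(4) M by (simp add: r_def del: funpow.simps)
  then show WT: "?W = ?T"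
    using T W \<open>?W \<subseteq> ?T\<close> by (intro subspace_dim_equal) auto
  show "dim ((X ^^ k) ` ?W) = richardson_rank M a k"
  proof (cases "k \<le> r")
    case True
    then have "richardson_rank M a k \<le> dim ((X ^^ k) ` ?W)"
      using dim_image_le_add[OF gl_funpow[OF gl] W(2,1,3,4), of k] rk[of k]
        richardson_rank_snoc_le[of k c a M] M by (simp add: r_def)
    then show ?thesis using le[of k] by simp
  next
    case False
    \<comment> \<open>Applying X^m to X^r W = X^(r+1) U turns the rank on W into the next rank on
      U.\<close>
    then obtain m where m: "k = m + r" by (metis add.commute le_add_diff_inverse nat_le_linear)
    have "(X ^^ k) ` ?W = (X ^^ m) ` (X ^^ r) ` ?W" by (simp add: m funpow_add image_comp)
    also have "\<dots> = (X ^^ (m + Suc r)) ` ?U" by (simp only: r[symmetric] funpow_add image_comp)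
    finally have "(X ^^ k) ` ?W = (X ^^ Suc k) ` ?U" by (simp only: m add_Suc_right)
    then show ?thesis
      using rk[of "Suc k"] richardson_rank_snoc_ge[of c a k M] False by (simp only: r_def)
  qed
qed

text \<open>The top proper step of the flag is recovered from \<open>X\<close> as the set of \<open>u\<close> with
  \<open>X\<^sup>r u \<in> X\<^bsup>r+1\<^esup> V\<close>, and one descends.\<close>

lemma filtration_unique:
  assumes "filtration a V" "filtration a V'" "X \<in> lowering (length a) V" "X \<in> lowering (length a) V'"
    and "\<forall>x\<in>set a. x \<le> M" and "V (length a) = V' (length a)"
    and "\<And>k. dim ((X ^^ k) ` V (length a)) = richardson_rank M a k"
    and "i \<le> length a"
  shows "V i = V' i"
  using assms
proof (induction a rule: rev_induct)
  case (snoc c a)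
  have eq: "V (Suc (length a)) = V' (Suc (length a))" using snoc.prems(6) by simp
  have low: "X \<in> lowering (Suc (length a)) V" "X \<in> lowering (Suc (length a)) V'"
    using snoc.prems(3,4) by simp_all
  have rk: "dim ((X ^^ k) ` V (Suc (length a))) = richardson_rank M (a @ [c]) k" for k
    using snoc.prems(7)[of k] by simp
  note step = filtration_top_step[OF snoc.prems(1) low(1) snoc.prems(5) rk]
  note step' = filtration_top_step(1)[OF snoc.prems(2) low(2) snoc.prems(5) rk[unfolded eq]]
  show ?case
  proof (cases "i = Suc (length a)")
    case False
    show ?thesis
    proof (rule snoc.IH)
      show "V (length a) = V' (length a)" using step(1) step' eq by simp
    qed (use snoc.prems low step(2) False in \<open>auto simp: filtration_snoc lowering_Suc\<close>)
  qed (use eq in simp)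
qed (auto simp: filtration_def)

end

section \<open>Existence of Richardson elements\<close>

text \<open>The pair \<open>(j, t)\<close> stands for the \<open>t\<close>-th vector of the \<open>j\<close>-th Jordan chain.\<close>

definition young_diagram :: "nat list \<Rightarrow> (nat \<times> nat) set" where
  "young_diagram a = {(j, t). t < conj_part a j}"

lemma young_diagram_snoc:
  "young_diagram (a @ [c]) = young_diagram a \<union> (\<lambda>j. (j, conj_part a j)) ` {..<c}"
  by (auto simp: young_diagram_def conj_part_snoc less_Suc_eq split: if_splits)

lemma young_diagram_disjoint: "young_diagram a \<inter> (\<lambda>j. (j, conj_part a j)) ` J = {}"
  by (auto simp: young_diagram_def)

lemma finite_young_diagram [simp]: "finite (young_diagram a)"
  by (induction a rule: rev_induct) (auto simp: young_diagram_snoc, simp add: young_diagram_def)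

lemma card_young_diagram: "card (young_diagram a) = sum_list a"
proof (induction a rule: rev_induct)
  case (snoc c a)
  have "card ((\<lambda>j. (j, conj_part a j)) ` {..<c}) = c"
    by (subst card_image) (auto simp: inj_on_def)
  then show ?case
    using snoc young_diagram_disjoint[of a "{..<c}"]
    by (simp add: young_diagram_snoc card_Un_disjoint)
qed (simp add: young_diagram_def)

lemma conj_part_take_le: "conj_part (take i a) j \<le> conj_part a j"
proof -
  have "conj_part a j = conj_part (take i a) j + conj_part (drop i a) j"
    unfolding conj_part_def by (metis append_take_drop_id filter_append length_append)
  then show ?thesis by simp
qed

lemma young_diagram_take: "young_diagram (take i a) \<subseteq> young_diagram a"
  using conj_part_take_le[of i a] by (auto simp: young_diagram_def intro: less_le_trans)

lemma card_shifted_diagram: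
  assumes "\<forall>x\<in>set a. x \<le> M"
  shows "card {(j, t). t + k < conj_part a j} = richardson_rank M a k"
proof -
  have "{(j, t). t + k < conj_part a j} = (SIGMA j:{..<M}. {..<conj_part a j - k})"
  proof -
    have "j < M" if "t + k < conj_part a j" for j t
    proof (rule ccontr)
      assume "\<not> j < M"
      then have "conj_part a j = 0" using assms by (intro conj_part_eq_0) auto
      then show False using that by simp
    qed
    then show ?thesis by auto
  qed
  then show ?thesis by (simp add: richardson_rank_def)
qed

context fin_linear_group begin

text \<open>A basis adapted to the flag is indexed so that the \<open>c\<close> vectors added by an
  entry \<open>c\<close> occupy one new box in each of the first \<open>c\<close> columns. Going
  down a column then means going down in the flag.\<close>

lemma adapted_basis:
  assumes "filtration a V"
  shows "\<exists>f. inj_on f (young_diagram a) \<and> independent (f ` young_diagram a) \<and>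
    (\<forall>i\<le>length a. span (f ` young_diagram (take i a)) = V i)"
  using assms
proof (induction a rule: rev_induct)
  case Nil
  then show ?case by (auto simp: filtration_def young_diagram_def independent_empty)
next
  case (snoc c a)
  have V: "filtration a V" "subspace (V (Suc (length a)))" "V (length a) \<subseteq> V (Suc (length a))"
    "dim (V (Suc (length a))) = dim (V (length a)) + c"
    using snoc.prems by (auto simp: filtration_snoc)
  obtain f where f: "inj_on f (young_diagram a)" "independent (f ` young_diagram a)"
    "\<forall>i\<le>length a. span (f ` young_diagram (take i a)) = V i"
    using snoc.IH[OF V(1)] by blast
  let ?B = "f ` young_diagram a"
  have B: "span ?B = V (length a)" using f(3) by (metis order_refl take_all)
  then have "?B \<subseteq> V (Suc (length a))" using V(3) span_superset by blast
  then obtain C where C: "?B \<subseteq> C" "independent C" "span C = V (Suc (length a))"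
    using extend_basis_subspace[OF V(2) f(2)] by metis
  have finC: "finite C" using C(2) by (rule finiteI_independent)
  have "card C = card ?B + c"
    using V(4) B C f(2) by (metis dim_span_eq_card_independent)
  then have "card (C - ?B) = c" using C(1) finC by (simp add: card_Diff_subset finite_subset)
  then obtain h where h: "bij_betw h {..<c} (C - ?B)"
    using finC ex_bij_betw_nat_finite[of "C - ?B"] by (auto simp: lessThan_atLeast0)
  \<comment> \<open>On the new boxes the height is determined by the column, so \<open>h j\<close>
    is the new top of column \<open>j\<close>.\<close>
  define f' where "f' = (\<lambda>(j, t). if (j, t) \<in> young_diagram a then f (j, t) else h j)"
  have old: "f' ` S = f ` S" if "S \<subseteq> young_diagram a" for S
    using that by (intro image_cong) (auto simp: f'_def)
  have "f' ` (\<lambda>j. (j, conj_part a j)) ` {..<c} = h ` {..<c}"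
    unfolding image_image by (intro image_cong) (auto simp: f'_def young_diagram_def)
  then have new: "f' ` young_diagram (a @ [c]) = C"
    using h C(1) old[of "young_diagram a"]
    by (auto simp: young_diagram_snoc image_Un bij_betw_def)
  have "card (young_diagram (a @ [c])) = card C"
    using \<open>card C = card ?B + c\<close> f(1) by (simp add: card_image card_young_diagram)
  then have "inj_on f' (young_diagram (a @ [c]))"
    using new by (intro eq_card_imp_inj_on) auto
  moreover have "span (f' ` young_diagram (take i (a @ [c]))) = V i" if "i \<le> length (a @ [c])" for i
  proof (cases "i = Suc (length a)")
    case True
    then show ?thesis using new C by simp
  next
    case False
    then have "i \<le> length a" using that by simp
    then show ?thesis using f(3) old[OF young_diagram_take, of i] by simp
  qed
  ultimately show ?case using new C(2) by (intro exI[of _ f']) auto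
qed

text \<open>\<open>X\<close> moves every box one place down its column and kills the bottom row. The
  image of X^k then contains the basis vectors of all boxes with at least \<open>k\<close> boxes
  above them; their number is the desired rank, and \<open>lowering_rank_le\<close> gives the other
  inequality.\<close>

lemma exists_richardson_element:
  assumes V: "filtration a V" and M: "\<forall>x\<in>set a. x \<le> M"
  shows "\<exists>X\<in>lowering (length a) V. \<forall>k. dim ((X ^^ k) ` V (length a)) = richardson_rank M a k"
proof -
  let ?J = "young_diagram a"
  obtain f where f: "inj_on f ?J" "independent (f ` ?J)"
    "\<forall>i\<le>length a. span (f ` young_diagram (take i a)) = V i"
    using adapted_basis[OF V] by blast
  obtain X where X: "X \<in> gl"
    "\<forall>b\<in>f ` ?J. X b = (case inv_into ?J f b of (j, t) \<Rightarrow> if t = 0 then 0 else f (j, t - 1))"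
    by (rule extend_to_gl[OF f(2)])
  have Xf: "X (f (j, t)) = (if t = 0 then 0 else f (j, t - 1))" if "(j, t) \<in> ?J" for j t
    using X(2) that f(1) by simp
  \<comment> \<open>One entry adds at most one box to a column, so the box below any box of stage
    \<open>Suc i\<close> is already present at stage \<open>i\<close>.\<close>
  have step: "conj_part (take (Suc i) a) j \<le> Suc (conj_part (take i a) j)" if "i < length a" for i j
    using that by (simp add: take_Suc_conv_app_nth conj_part_snoc)
  have "X v \<in> V i" if i: "i < length a" and v: "v \<in> V (Suc i)" for i v
  proof (rule span_induct_gl[OF X(1) filtration_subspace[OF V]])
    show "v \<in> span (f ` young_diagram (take (Suc i) a))" using f(3) i v by simp
    fix b assume "b \<in> f ` young_diagram (take (Suc i) a)"
    then obtain j t where b: "b = f (j, t)" "(j, t) \<in> young_diagram (take (Suc i) a)" by auto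
    then have "(j, t) \<in> ?J" using young_diagram_take by blast
    show "X b \<in> V i"
    proof (cases "t = 0")
      case True
      then show ?thesis
        using b Xf[OF \<open>(j, t) \<in> ?J\<close>] subspace_0[OF filtration_subspace[OF V]] i by simp
    next
      case False
      then have "(j, t - 1) \<in> young_diagram (take i a)"
        using b(2) step[OF i, of j] by (auto simp: young_diagram_def)
      then have "f (j, t - 1) \<in> span (f ` young_diagram (take i a))" by (intro span_base imageI)
      then show ?thesis using b False Xf[OF \<open>(j, t) \<in> ?J\<close>] f(3) i by simp
    qed
  qed (use i in simp)
  then have low: "X \<in> lowering (length a) V" using X(1) by (auto simp: lowering_def)
  have pow: "(X ^^ k) (f (j, t + k)) = f (j, t)" if "(j, t + k) \<in> ?J" for j t k
    using that
  proof (induction k)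
    case (Suc k)
    then have "(j, t + k) \<in> ?J" by (auto simp: young_diagram_def)
    then show ?case using Suc Xf[of j "t + Suc k"] by (simp add: funpow_Suc_right del: funpow.simps)
  qed simp
  have "richardson_rank M a k \<le> dim ((X ^^ k) ` V (length a))" for k
  proof -
    let ?S = "{(j, t). t + k < conj_part a j}"
    have S: "?S \<subseteq> ?J" by (auto simp: young_diagram_def)
    have "f ` ?J \<subseteq> V (length a)" using f(3) span_superset by (metis order_refl take_all)
    have "f ` ?S \<subseteq> (X ^^ k) ` V (length a)"
    proof
      fix b assume "b \<in> f ` ?S"
      then obtain j t where "b = f (j, t)" and J: "(j, t + k) \<in> ?J" by (auto simp: young_diagram_def)
      then have "b = (X ^^ k) (f (j, t + k))" using pow by simp
      then show "b \<in> (X ^^ k) ` V (length a)" using J \<open>f ` ?J \<subseteq> V (length a)\<close> by blast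
    qed
    moreover have "independent (f ` ?S)" using independent_mono[OF f(2)] S by blast
    ultimately have "card (f ` ?S) \<le> dim ((X ^^ k) ` V (length a))" by (rule independent_card_le_dim)
    moreover have "card (f ` ?S) = card ?S" using f(1) S by (meson card_image inj_on_subset)
    ultimately show ?thesis using card_shifted_diagram[OF M] by simp
  qed
  then show ?thesis using low lowering_rank_le[OF V low M] by (meson order_antisym)
qed

section \<open>The general linear group and its Zariski topology\<close>

lemma GL_carrier: "g \<in> carrier GL \<longleftrightarrow> g \<in> gl \<and> bij g"
  by (simp add: GL_def)

lemma GL_mult [simp]: "g \<otimes>\<^bsub>GL\<^esub> h = g \<circ> h" and GL_one [simp]: "\<one>\<^bsub>GL\<^esub> = id"
  by (simp_all add: GL_def)

lemma inv_into_GL: "g \<in> carrier GL \<Longrightarrow> inv_into UNIV g \<in> carrier GL"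
proof -
  assume "g \<in> carrier GL"
  then have g: "g \<in> gl" "bij g" by (simp_all add: GL_carrier)
  have eqI: "inv_into UNIV g v = w" if "v = g w" for v w
    using that g(2) by (simp add: bij_is_inj)
  have inv: "g (inv_into UNIV g v) = v" for v using g(2) by (simp add: bij_is_surj surj_f_inv_f)
  have "inv_into UNIV g \<in> gl" by (rule glI; rule eqI) (simp_all add: g(1) gl_add gl_scale inv)
  then show ?thesis using g by (simp add: GL_carrier bij_imp_bij_inv)
qed

lemma GL_group: "group GL"
proof (rule groupI)
  fix g assume "g \<in> carrier GL"
  then show "\<exists>h\<in>carrier GL. h \<otimes>\<^bsub>GL\<^esub> g = \<one>\<^bsub>GL\<^esub>"
    using inv_into_GL by (intro bexI[of _ "inv_into UNIV g"]) (auto simp: GL_carrier bij_is_inj)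
qed (auto simp: GL_carrier gl_comp bij_comp comp_assoc)

lemma GL_inv: "g \<in> carrier GL \<Longrightarrow> inv\<^bsub>GL\<^esub> g = inv_into UNIV g"
  using group.inv_equality[OF GL_group] inv_into_GL
  by (metis GL_carrier GL_mult GL_one bij_is_inj inv_o_cancel)

text \<open>Turns conjugation into an intertwining relation, the form in which
  \<open>nilpotent_conjugate\<close> supplies it.\<close>

lemma Ad_eq_iff:
  assumes "g \<in> carrier GL"
  shows "Ad g X = Y \<longleftrightarrow> (\<forall>v. g (X v) = Y (g v))"
proof -
  have g: "bij g" using assms by (simp add: GL_carrier)
  have "g (X (inv_into UNIV g (g v))) = g (X v)" "g (inv_into UNIV g v) = v" for v
    using g by (simp_all add: bij_is_inj bij_is_surj surj_f_inv_f)
  then show ?thesis unfolding Ad_def GL_inv[OF assms] fun_eq_iff comp_apply by metis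
qed

lemma Ad_id: "Ad id X = X"
  using Ad_eq_iff[of id] by (simp add: GL_carrier)

lemma Ad_comp:
  assumes "g \<in> carrier GL" "h \<in> carrier GL"
  shows "Ad (g \<circ> h) X = Ad g (Ad h X)"
proof -
  have "g \<circ> h \<in> carrier GL" using assms by (simp add: GL_carrier gl_comp bij_comp)
  then show ?thesis using assms by (simp add: Ad_eq_iff flip: Ad_eq_iff[OF assms(1)]) (metis Ad_eq_iff assms)
qed

lemma Ad_gl: "g \<in> carrier GL \<Longrightarrow> X \<in> gl \<Longrightarrow> Ad g X \<in> gl"
  unfolding Ad_def using inv_into_GL by (auto simp: GL_inv GL_carrier intro!: gl_comp)

section \<open>Linear forms, regular functions on lines, and irreducibility of affine
  subspaces\<close>

lemma separating_form:
  assumes W: "subspace W" and "w \<notin> W"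
  obtains \<phi> where "Vector_Spaces.linear scale (*) \<phi>" "\<forall>v\<in>W. \<phi> v = 0" "\<phi> w = 1"
proof -
  obtain B where B: "independent B" "span B = W" using basis_subspace_exists[OF W] by metis
  then have "independent (insert w B)" using assms by (intro independent_insertI) auto
  then obtain \<phi> where \<phi>: "Vector_Spaces.linear scale (*) \<phi>"
    "\<forall>x\<in>insert w B. \<phi> x = (if x = w then 1 else 0)"
    using form.linear_independent_extend[of "insert w B" "\<lambda>x. if x = w then 1 else 0"] by blast
  have "w \<notin> B" using B assms span_base by blast
  have "\<phi> b = 0" if "b \<in> B" for b using \<phi>(2) that \<open>w \<notin> B\<close> by auto
  then have "\<phi> v = 0" if "v \<in> W" for v
    using form.linear_eq_0_on_span[OF \<phi>(1), of B v] B that by auto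
  then show thesis using \<phi> that by auto
qed

lemma topspace_zariski: "topspace zariski = gl"
proof -
  have "zariski_open gl"
    unfolding zariski_open_def
    by (rule exI[of _ "{\<lambda>_. 1}"]) (auto intro: regular.const)
  moreover have "U \<subseteq> gl" if "zariski_open U" for U using that by (auto simp: zariski_open_def)
  ultimately show ?thesis unfolding topspace_def openin_zariski by blast
qed

text \<open>Irreducibility uses lines through an arbitrary point \<open>A\<close>, whereas tangent
  spaces use only lines through the identity.\<close>

lemma regular_on_line:
  assumes "p \<in> regular"
  shows "\<exists>q. \<forall>t. poly q t = p (\<lambda>v. A v + scale t (B v))"
  using assms
proof induction
  case (const c)
  show ?case by (rule exI[of _ "[:c:]"]) simp
next
  case (coeff \<phi> v)
  interpret \<phi>: Vector_Spaces.linear scale "(*)" \<phi> by (fact coeff)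
  show ?case
    by (rule exI[of _ "[:\<phi> (A v), \<phi> (B v):]"]) (simp add: \<phi>.add \<phi>.scale)
next
  case (add p q)
  then show ?case by (metis poly_add)
next
  case (mult p q)
  then show ?case by (metis poly_mult)
qed

text \<open>As the field is infinite, a polynomial function that is nonzero at a point has only finitely
  many zeros on any line through it.\<close>

lemma affine_irreducible:
  assumes S: "S \<subseteq> gl" and line: "\<And>A B t. A \<in> S \<Longrightarrow> B \<in> S \<Longrightarrow> (\<lambda>v. A v + scale t (B v - A v)) \<in> S"
    and "openin zariski U" "openin zariski W" "S \<inter> U \<noteq> {}" "S \<inter> W \<noteq> {}"
  shows "S \<inter> U \<inter> W \<noteq> {}"
proof -
  obtain A B where A: "A \<in> S" "A \<in> U" and B: "B \<in> S" "B \<in> W" using assms by blast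
  obtain p where p: "p \<in> regular" "p A \<noteq> 0" "\<And>X. X \<in> gl \<Longrightarrow> p X \<noteq> 0 \<Longrightarrow> X \<in> U"
    using A assms(3) unfolding openin_zariski zariski_open_def by blast
  obtain q where q: "q \<in> regular" "q B \<noteq> 0" "\<And>X. X \<in> gl \<Longrightarrow> q X \<noteq> 0 \<Longrightarrow> X \<in> W"
    using B assms(4) unfolding openin_zariski zariski_open_def by blast
  let ?L = "\<lambda>t v. A v + scale t (B v - A v)"
  obtain p' where p': "\<And>t. poly p' t = p (?L t)" using regular_on_line[OF p(1)] by metis
  obtain q' where q': "\<And>t. poly q' t = q (?L t)" using regular_on_line[OF q(1)] by metis
  have "poly p' 0 \<noteq> 0" "poly q' 1 \<noteq> 0" using p q by (simp_all add: p' q')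
  then have "p' * q' \<noteq> 0" by auto
  then have "finite {t. poly (p' * q') t = 0}" by (rule poly_roots_finite)
  then obtain t where "poly (p' * q') t \<noteq> 0"
    using infinite_UNIV_char_0[where 'a='k] by (metis (mono_tags, lifting) UNIV_eq_I mem_Collect_eq)
  then have "p (?L t) \<noteq> 0" "q (?L t) \<noteq> 0" by (simp_all add: p' q')
  moreover have "?L t \<in> S" using A B line by blast
  ultimately show ?thesis using p q S by blast
qed

text \<open>A separation would consist of two open sets that both meet \<open>S\<close> but have no
  common point in it, contrary to irreducibility.\<close>

lemma affine_connected:
  assumes S: "S \<subseteq> gl" and line: "\<And>A B t. A \<in> S \<Longrightarrow> B \<in> S \<Longrightarrow> (\<lambda>v. A v + scale t (B v - A v)) \<in> S"
  shows "connectedin zariski S"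
  unfolding connectedin topspace_zariski using S affine_irreducible[OF S line] by blast

end

section \<open>The parabolic subgroup of a flag\<close>

locale flag = fin_linear_group scale Basis
  for scale :: "'k::field_char_0 \<Rightarrow> 'v::ab_group_add \<Rightarrow> 'v"
    and Basis :: "'v set" +
  fixes a :: "nat list" and V :: "nat \<Rightarrow> 'v set"
  assumes filtration: "filtration a V" and top: "V (length a) = UNIV"
begin

definition parabolic :: "('v \<Rightarrow> 'v) set" where
  "parabolic = {g \<in> carrier GL. \<forall>i\<le>length a. g ` V i = V i}"

definition unipotent_part :: "('v \<Rightarrow> 'v) set" where
  "unipotent_part = {g \<in> gl. (\<lambda>v. g v - v) \<in> lowering (length a) V}"

lemma subspace_V: "i \<le> length a \<Longrightarrow> subspace (V i)"
  using filtration_subspace[OF filtration] .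

lemma V_0 [simp]: "V 0 = {0}"
  using filtration by (simp add: filtration_def)

lemma V_Suc: "i < length a \<Longrightarrow> v \<in> V i \<Longrightarrow> v \<in> V (Suc i)"
  using filtration by (auto simp: filtration_def)

text \<open>An injective linear map preserves dimensions, so mapping \<open>V i\<close> into itself
  already means mapping it onto itself.\<close>

lemma parabolicI:
  assumes "g \<in> carrier GL" "\<And>i v. i \<le> length a \<Longrightarrow> v \<in> V i \<Longrightarrow> g v \<in> V i"
  shows "g \<in> parabolic"
proof -
  have g: "g \<in> gl" "inj g" using assms(1) by (auto simp: GL_carrier bij_is_inj)
  have "g ` V i = V i" if "i \<le> length a" for i
  proof (rule subspace_dim_equal)
    show "dim (V i) \<le> dim (g ` V i)"
      using dim_image_gl_eq[OF g(1) subspace_V[OF that]] inj_on_subset[OF g(2)] by simp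
  qed (use assms that g subspace_V subspace_image_gl in auto)
  then show ?thesis using assms(1) by (simp add: parabolic_def)
qed

lemma parabolicD:
  assumes "g \<in> parabolic"
  shows "g \<in> carrier GL" "g \<in> gl" "bij g" "i \<le> length a \<Longrightarrow> v \<in> V i \<Longrightarrow> g v \<in> V i"
  using assms by (auto simp: parabolic_def GL_carrier)

lemma parabolic_inv: "g \<in> parabolic \<Longrightarrow> inv_into UNIV g \<in> parabolic"
proof (rule parabolicI)
  assume g: "g \<in> parabolic"
  show "inv_into UNIV g \<in> carrier GL" using g by (intro inv_into_GL) (rule parabolicD)
  fix i v assume "i \<le> length a" "v \<in> V i"
  then obtain w where "w \<in> V i" "v = g w" using g unfolding parabolic_def by blast
  then show "inv_into UNIV g v \<in> V i" using parabolicD(3)[OF g] by (simp add: bij_is_inj)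
qed

lemma parabolic_comp: "g \<in> parabolic \<Longrightarrow> h \<in> parabolic \<Longrightarrow> g \<circ> h \<in> parabolic"
  by (rule parabolicI) (auto simp: parabolicD(4) GL_carrier parabolicD gl_comp bij_comp)

lemma parabolic_id: "id \<in> parabolic"
  by (rule parabolicI) (auto simp: GL_carrier)

lemma subgroup_parabolic: "subgroup parabolic GL"
  by (rule group.subgroupI[OF GL_group])
    (use parabolicD(1) parabolic_inv parabolic_comp parabolic_id in \<open>auto simp: GL_inv\<close>)

abbreviation "PG \<equiv> GL\<lparr>carrier := parabolic\<rparr>"

lemma PG_group: "group PG"
  using group.subgroup_imp_group[OF GL_group subgroup_parabolic] .

lemma PG_inv: "g \<in> parabolic \<Longrightarrow> inv\<^bsub>PG\<^esub> g = inv_into UNIV g"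
  using group.m_inv_consistent[OF GL_group subgroup_parabolic] by (simp add: GL_inv parabolicD)

section \<open>The unipotent part is normal, closed, connected and unipotent\<close>

lemma unipotent_partD:
  "g \<in> unipotent_part \<Longrightarrow> i < length a \<Longrightarrow> v \<in> V (Suc i) \<Longrightarrow> g v - v \<in> V i"
  by (auto simp: unipotent_part_def lowering_def)

lemma gl_minus_id: "g \<in> gl \<Longrightarrow> (\<lambda>v. g v - v) \<in> gl"
  by (rule glI) (simp_all add: gl_add gl_scale scale_right_diff_distrib)

lemma gl_plus_id: "X \<in> gl \<Longrightarrow> (\<lambda>v. v + scale t (X v)) \<in> gl"
  by (rule glI) (simp_all add: gl_add gl_scale scale_right_distrib scale_left_commute)

lemma unipotent_partI:
  "g \<in> gl \<Longrightarrow> (\<And>i v. i < length a \<Longrightarrow> v \<in> V (Suc i) \<Longrightarrow> g v - v \<in> V i) \<Longrightarrow> g \<in> unipotent_part"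
  by (auto simp: unipotent_part_def lowering_def gl_minus_id)

text \<open>The truncated subtraction is intended: once the index has reached 0, the vector is 0 and
  remains so.\<close>

lemma lowering_pow: "X \<in> lowering (length a) V \<Longrightarrow> (X ^^ k) v \<in> V (length a - k)"
proof (induction k)
  case (Suc k)
  show ?case
  proof (cases "length a - k")
    case 0
    then show ?thesis using Suc by (auto simp: lowering_def)
  next
    case (Suc i)
    then have "i < length a" "length a - Suc k = i" by auto
    then show ?thesis using Suc.IH Suc Suc.prems by (auto simp: lowering_def)
  qed
qed (simp add: top)

lemma lowering_nilpotent: "X \<in> lowering (length a) V \<Longrightarrow> (X ^^ length a) v = 0"
  using lowering_pow[of X "length a" v] by simp

lemma unipotent_part_parabolic: "unipotent_part \<subseteq> parabolic"
proof
  fix g assume g: "g \<in> unipotent_part"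
  then have gl: "g \<in> gl" by (simp add: unipotent_part_def)
  have "v = 0" if "g v = 0" for v
  proof -
    \<comment> \<open>Since g v = 0, the vector v equals -(g v - v) and drops one step of the flag
      each time; starting from the whole space it ends in \<open>V 0\<close>.\<close>
    have "v \<in> V (length a - k)" for k
    proof (induction k)
      case (Suc k)
      show ?case
      proof (cases "length a - k")
        case 0
        then show ?thesis using Suc by auto
      next
        case (Suc i)
        then have i: "i < length a" "length a - Suc k = i" by auto
        then have "g v - v \<in> V i" using Suc.IH Suc by (intro unipotent_partD[OF g]) auto
        then show ?thesis using that i subspace_neg[OF subspace_V, of i "- v"] by simp
      qed
    qed (simp add: top)
    then show ?thesis using V_0 by (metis diff_self_eq_0 singletonD)
  qed
  then have "inj g" using inj_on_gl_iff[OF gl subspace_UNIV] by simp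
  moreover have "surj g"
    using \<open>inj g\<close> gl linear_inj_imp_surj[of g] by (simp add: gl_def)
  ultimately have "g \<in> carrier GL" using gl by (simp add: GL_carrier bij_def)
  moreover have "g v \<in> V i" if "i \<le> length a" "v \<in> V i" for i v
  proof (cases i)
    case (Suc j)
    then have "g v - v \<in> V i" using unipotent_partD[OF g, of j v] V_Suc[of j] that by auto
    then have "(g v - v) + v \<in> V i" using that subspace_V by (intro subspace_add) auto
    then show ?thesis by simp
  qed (use that gl in auto)
  ultimately show "g \<in> parabolic" by (rule parabolicI)
qed

lemma unipotent_part_subgroup: "subgroup unipotent_part PG"
proof (rule group.subgroupI[OF PG_group])
  show "unipotent_part \<subseteq> carrier PG" using unipotent_part_parabolic by simp
  show "unipotent_part \<noteq> {}"
    using unipotent_partI[of id] subspace_0[OF subspace_V] by force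
next
  fix g assume g: "g \<in> unipotent_part"
  then have P: "g \<in> parabolic" using unipotent_part_parabolic by blast
  let ?h = "inv_into UNIV g"
  have h: "?h \<in> parabolic" by (rule parabolic_inv[OF P])
  have "?h \<in> unipotent_part"
  proof (rule unipotent_partI)
    fix i v assume i: "i < length a" "v \<in> V (Suc i)"
    have "g (?h v) - ?h v \<in> V i" using unipotent_partD[OF g i(1)] parabolicD(4)[OF h] i by simp
    then have "v - ?h v \<in> V i" using parabolicD(3)[OF P] by (simp add: bij_is_surj surj_f_inv_f)
    then show "?h v - v \<in> V i" using subspace_neg[OF subspace_V, of i "v - ?h v"] i by simp
  qed (rule parabolicD(2)[OF h])
  then show "inv\<^bsub>PG\<^esub> g \<in> unipotent_part" using PG_inv[OF P] by simp
next
  fix g h assume gh: "g \<in> unipotent_part" "h \<in> unipotent_part"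
  have P: "g \<in> parabolic" "h \<in> parabolic" using gh unipotent_part_parabolic by auto
  have "g \<circ> h \<in> unipotent_part"
  proof (rule unipotent_partI)
    fix i v assume i: "i < length a" "v \<in> V (Suc i)"
    have "g (h v) - h v \<in> V i" using unipotent_partD[OF gh(1) i(1)] parabolicD(4)[OF P(2)] i by simp
    moreover have "h v - v \<in> V i" using unipotent_partD[OF gh(2)] i by blast
    ultimately have "(g (h v) - h v) + (h v - v) \<in> V i" using subspace_V i by (intro subspace_add) auto
    then show "(g \<circ> h) v - v \<in> V i" by simp
  qed (use P parabolicD gl_comp in blast)
  then show "g \<otimes>\<^bsub>PG\<^esub> h \<in> unipotent_part" by simp
qed

lemma unipotent_part_normal: "unipotent_part \<lhd> PG"
proof -
  have "g \<circ> n \<circ> inv_into UNIV g \<in> unipotent_part" if g: "g \<in> parabolic" and n: "n \<in> unipotent_part" for g n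
  proof (rule unipotent_partI)
    let ?h = "inv_into UNIV g"
    have h: "?h \<in> parabolic" by (rule parabolic_inv[OF g])
    have N: "n \<in> parabolic" using n unipotent_part_parabolic by auto
    show "g \<circ> n \<circ> ?h \<in> gl" using parabolicD(2) g h N by (intro gl_comp) auto
    fix i v assume i: "i < length a" "v \<in> V (Suc i)"
    have "n (?h v) - ?h v \<in> V i" using unipotent_partD[OF n i(1)] parabolicD(4)[OF h] i by simp
    then have "g (n (?h v) - ?h v) \<in> V i" using parabolicD(4)[OF g] i by simp
    then show "(g \<circ> n \<circ> ?h) v - v \<in> V i"
      using parabolicD(2,3)[OF g] by (simp add: gl_diff bij_is_surj surj_f_inv_f)
  qed
  then show ?thesis
    using unipotent_part_subgroup by (simp add: group.normal_inv_iff[OF PG_group] PG_inv)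
qed

lemma unipotent_part_closed: "closedin (subtopology zariski (carrier GL)) unipotent_part"
proof -
  \<comment> \<open>These affine functions test g v - v \<in> V i through the linear forms vanishing
    on \<open>V i\<close>. They are written with \<open>+ -\<close> to match the generating rules of
    \<open>regular\<close>.\<close>
  define S where "S = {(\<lambda>X. \<phi> (X v) + - \<phi> v) | i \<phi> v. i < length a \<and> v \<in> V (Suc i) \<and>
    Vector_Spaces.linear scale (*) \<phi> \<and> (\<forall>w\<in>V i. \<phi> w = 0)}"
  have "S \<subseteq> regular"
    unfolding S_def by clarify (intro regular.add regular.coeff regular.const)
  have "g \<notin> unipotent_part \<longleftrightarrow> (\<exists>p\<in>S. p g \<noteq> 0)" if g: "g \<in> gl" for g
  proof
    assume "g \<notin> unipotent_part"
    then obtain i v where i: "i < length a" "v \<in> V (Suc i)" "g v - v \<notin> V i"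
      using unipotent_partI g by blast
    then obtain \<phi> where \<phi>: "Vector_Spaces.linear scale (*) \<phi>" "\<forall>w\<in>V i. \<phi> w = 0" "\<phi> (g v - v) = 1"
      using separating_form[OF subspace_V] by (metis less_imp_le)
    then have "\<phi> (g v) + - \<phi> v \<noteq> 0" using form.linear_diff[OF \<phi>(1)] by simp
    moreover have "(\<lambda>X. \<phi> (X v) + - \<phi> v) \<in> S" unfolding S_def using i \<phi> by blast
    ultimately show "\<exists>p\<in>S. p g \<noteq> 0" by (rule bexI[where P = "\<lambda>p. p g \<noteq> 0"])
  next
    assume "\<exists>p\<in>S. p g \<noteq> 0"
    then obtain i \<phi> v where i: "i < length a" "v \<in> V (Suc i)" "Vector_Spaces.linear scale (*) \<phi>"
      "\<forall>w\<in>V i. \<phi> w = 0" "\<phi> (g v) + - \<phi> v \<noteq> 0" unfolding S_def by blast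
    then have "\<phi> (g v - v) \<noteq> 0" using form.linear_diff[OF i(3)] by simp
    then show "g \<notin> unipotent_part" using unipotent_partD[of g] i by blast
  qed
  then have "gl - unipotent_part = {X \<in> gl. \<exists>p\<in>S. p X \<noteq> 0}" by blast
  then have "openin zariski (gl - unipotent_part)"
    unfolding openin_zariski zariski_open_def using \<open>S \<subseteq> regular\<close> by blast
  moreover have "unipotent_part \<subseteq> gl" by (auto simp: unipotent_part_def)
  ultimately have "closedin zariski unipotent_part"
    by (simp add: closedin_def topspace_zariski)
  moreover have "unipotent_part \<subseteq> carrier GL" using unipotent_part_parabolic parabolicD(1) by blast
  ultimately show ?thesis by (auto simp: closedin_subtopology)
qed

text \<open>The set is the translate of a linear subspace by the identity, so it contains the line
  through any two of its points.\<close>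

lemma unipotent_part_connected: "connectedin zariski unipotent_part"
proof (rule affine_connected)
  show "unipotent_part \<subseteq> gl" by (auto simp: unipotent_part_def)
  fix A B t assume AB: "A \<in> unipotent_part" "B \<in> unipotent_part"
  then have gl: "A \<in> gl" "B \<in> gl" by (auto simp: unipotent_part_def)
  show "(\<lambda>v. A v + scale t (B v - A v)) \<in> unipotent_part"
  proof (rule unipotent_partI)
    show "(\<lambda>v. A v + scale t (B v - A v)) \<in> gl"
      by (rule glI) (simp_all add: gl gl_add gl_scale algebra_simps)
    fix i v assume i: "i < length a" "v \<in> V (Suc i)"
    have AB': "A v - v \<in> V i" "B v - v \<in> V i" using unipotent_partD AB i by blast+
    then have "scale t ((B v - v) - (A v - v)) \<in> V i"
      using subspace_V i by (intro subspace_scale subspace_diff[OF _ AB'(2,1)]) auto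
    then have "(A v - v) + scale t ((B v - v) - (A v - v)) \<in> V i"
      using subspace_V i AB' by (intro subspace_add[of "V i"]) auto
    then show "A v + scale t (B v - A v) - v \<in> V i" by (simp add: algebra_simps)
  qed
qed

lemma unipotent_part_unipotent: "g \<in> unipotent_part \<Longrightarrow> unipotent g"
  unfolding unipotent_def unipotent_part_def using lowering_nilpotent by blast

text \<open>Let \<open>g\<close> belong to a normal unipotent subgroup of the parabolic subgroup, and suppose that
  \<open>g\<close> acts nontrivially on \<open>V\<^bsub>i+1\<^esub>/V\<^sub>i\<close>. Modulo \<open>V\<^sub>i\<close> there is a pair \<open>w, u\<close> with \<open>g w = w + u\<close> and
  \<open>g u = u\<close>. For the element \<open>h\<close> of the parabolic subgroup that swaps \<open>w\<close> and \<open>u\<close>, the product of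
  \<open>g\<close> and \<open>h g h\<close> acts on the plane spanned by \<open>u, w\<close> by \<open>u \<mapsto> 2 u + w, w \<mapsto> u + w\<close>, which is
  not unipotent.\<close>

lemma normal_unipotent_le:
  assumes N: "N \<lhd> PG" and uni: "\<forall>g\<in>N. unipotent g"
  shows "N \<subseteq> unipotent_part"
proof
  fix g assume gN: "g \<in> N"
  have sub: "subgroup N PG" using N by (simp add: group.normal_inv_iff[OF PG_group])
  have NP: "N \<subseteq> parabolic" using subgroup.subset[OF sub] by simp
  have comp: "x \<circ> y \<in> N" if "x \<in> N" "y \<in> N" for x y
    using subgroup.m_closed[OF sub that] by simp
  have g: "g \<in> parabolic" "g \<in> gl" using gN NP parabolicD by blast+
  show "g \<in> unipotent_part"
  proof (rule unipotent_partI[OF g(2)], rule ccontr)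
    fix i x assume i: "i < length a" and x: "x \<in> V (Suc i)" "g x - x \<notin> V i"
    define D where "D = (\<lambda>v. g v - v)"
    have D: "D \<in> gl" unfolding D_def by (rule gl_minus_id[OF g(2)])
    have DV: "D v \<in> V j" if "j \<le> length a" "v \<in> V j" for j v
      unfolding D_def using that parabolicD(4)[OF g(1)] subspace_V by (intro subspace_diff) auto
    have sV: "subspace (V i)" "subspace (V (Suc i))" using i subspace_V by auto
    obtain m where "(D ^^ m) x = 0" using uni gN unfolding unipotent_def D_def by blast
    then have "(D ^^ m) x \<in> V i" using subspace_0[OF sV(1)] by simp
    \<comment> \<open>Neither x nor D x lies in \<open>V i\<close>, the former because D preserves
      \<open>V i\<close>; hence n is at least 2. Stopping two and one steps before n yields
      \<open>w\<close> and \<open>u\<close>.\<close>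
    define n where "n = (LEAST n. (D ^^ n) x \<in> V i)"
    have n: "(D ^^ n) x \<in> V i" and least: "\<And>k. k < n \<Longrightarrow> (D ^^ k) x \<notin> V i"
      unfolding n_def using LeastI[of "\<lambda>n. (D ^^ n) x \<in> V i", OF \<open>(D ^^ m) x \<in> V i\<close>] not_less_Least by auto
    have "x \<notin> V i" using DV[of i x] x(2) i by (auto simp: D_def)
    then have "n \<noteq> 0" "n \<noteq> 1" using n x(2) by (metis funpow_0) (use n x(2) D_def in force)
    then obtain k where k: "n = Suc (Suc k)" by (metis One_nat_def not0_implies_Suc)
    define w where "w = (D ^^ k) x"
    define u where "u = D w"
    have pow: "(D ^^ l) x \<in> V (Suc i)" for l by (induction l) (use x DV i in auto)
    have w: "w \<in> V (Suc i)" "w \<notin> V i" using pow least[of k] k by (auto simp: w_def)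
    have u: "u \<in> V (Suc i)" "u \<notin> V i" "D u \<in> V i"
      using pow[of "Suc k"] least[of "Suc k"] n k by (auto simp: w_def u_def)
    \<comment> \<open>Modulo \<open>V i\<close>, D sends w to u and kills u, so \<beta> vanishes
      first and then \<alpha>.\<close>
    have coord: "\<alpha> = 0 \<and> \<beta> = 0" if "scale \<alpha> u + scale \<beta> w \<in> V i" for \<alpha> \<beta>
    proof -
      have "scale \<alpha> (D u) + scale \<beta> u \<in> V i"
        using DV[OF _ that] i D by (simp add: gl_add gl_scale u_def)
      then have "scale \<beta> u \<in> V i"
        using subspace_diff[OF sV(1) _ subspace_scale[OF sV(1) u(3), of \<alpha>]] by fastforce
      then have "\<beta> = 0" using subspace_scale[OF sV(1), of "scale \<beta> u" "inverse \<beta>"] u(2)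
        by (cases "\<beta> = 0") auto
      then have "scale \<alpha> u \<in> V i" using that by simp
      then have "\<alpha> = 0" using subspace_scale[OF sV(1), of "scale \<alpha> u" "inverse \<alpha>"] u(2)
        by (cases "\<alpha> = 0") auto
      then show ?thesis using \<open>\<beta> = 0\<close> by simp
    qed
    obtain B where B: "B \<subseteq> V i" "independent B" "span B = V i" using basis_subspace_exists[OF sV(1)] by metis
    have "u \<notin> span (insert w B)"
    proof
      assume "u \<in> span (insert w B)"
      then obtain c where "u - scale c w \<in> V i" using B(3) by (auto simp: span_breakdown_eq)
      then have "scale 1 u + scale (- c) w \<in> V i" by simp
      then show False using coord[of 1 "- c"] by simp
    qed
    then have ind: "independent (insert u (insert w B))"
      using B w by (intro independent_insertI) auto
    \<comment> \<open>Completing to a basis of the whole space lets \<open>h\<close> fix all other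
      basis vectors. So \<open>h\<close> is the identity on \<open>V i\<close> and moves every
      vector only by elements of \<open>V (Suc i)\<close>, which puts it in the parabolic
      subgroup.\<close>
    obtain C where C: "insert u (insert w B) \<subseteq> C" "independent C" "span C = UNIV"
      using extend_basis_subspace[OF subspace_UNIV ind] by auto
    obtain h where h: "h \<in> gl" "\<forall>b\<in>C. h b = (if b = w then u else if b = u then w else b)"
      by (rule extend_to_gl[OF C(2)])
    have "u \<noteq> w" using \<open>u \<notin> span (insert w B)\<close> span_base by blast
    then have huw: "h u = w" "h w = u" using h C by auto
    have hV: "h v = v" if "v \<in> V i" for v
    proof (rule endo.linear_eq_on_span[of h "\<lambda>v. v" B, simplified])
      fix b assume "b \<in> B"
      then have "b \<in> C" "b \<in> V i" using C(1) B(1) by auto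
      then have "b \<noteq> w" "b \<noteq> u" using w(2) u(2) by auto
      then show "h b = b" using h(2) \<open>b \<in> C\<close> by simp
    qed (use h that B gl_id in \<open>auto simp: gl_def\<close>)
    have hh: "h (h v) = v" for v
    proof -
      have "(h \<circ> h) v = id v"
      proof (rule endo.linear_eq_on_span[of "h \<circ> h" id C])
        show "(h \<circ> h) b = id b" if "b \<in> C" for b using h C that by auto
      qed (use gl_comp[OF h(1) h(1)] C gl_id in \<open>auto simp: gl_def\<close>)
      then show ?thesis by simp
    qed
    have diff: "h v - v \<in> V (Suc i)" for v
    proof (rule span_induct_gl[OF gl_minus_id[OF h(1)] sV(2)])
      show "h b - b \<in> V (Suc i)" if "b \<in> C" for b
        using h that u w subspace_0[OF sV(2)] subspace_diff[OF sV(2)] by auto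
    qed (simp add: C)
    have "bij h" using hh by (metis bijI')
    then have hGL: "h \<in> carrier GL" using h by (simp add: GL_carrier)
    have hP: "h \<in> parabolic"
    proof (rule parabolicI[OF hGL])
      fix j v assume j: "j \<le> length a" "v \<in> V j"
      show "h v \<in> V j"
      proof (cases "j \<le> i")
        case True
        then have "v \<in> V i" using filtration_mono[OF filtration, of j i] j i by auto
        then show ?thesis using hV j by simp
      next
        case False
        then have "h v - v \<in> V j" using filtration_mono[OF filtration, of "Suc i" j] j diff by auto
        then have "(h v - v) + v \<in> V j" using j subspace_V by (intro subspace_add) auto
        then show ?thesis by simp
      qed
    qed
    have "inv_into UNIV h = h" using hh \<open>bij h\<close> by (metis bij_inv_eq_iff ext)
    then have "h \<circ> g \<circ> h \<in> N"
      using N gN hP PG_inv[OF hP] by (auto simp: group.normal_inv_iff[OF PG_group])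
    define e where "e = g \<circ> (h \<circ> g \<circ> h)"
    have eN: "e \<in> N" unfolding e_def by (rule comp[OF gN \<open>h \<circ> g \<circ> h \<in> N\<close>])
    then have e: "e \<in> parabolic" using NP by blast
    define E where "E = (\<lambda>v. e v - v)"
    have E: "E \<in> gl" unfolding E_def by (rule gl_minus_id[OF parabolicD(2)[OF e]])
    have gw: "g w = w + u" by (simp add: u_def D_def)
    have gu: "g u = u + D u" by (simp add: D_def)
    have "e u = u + D u + (w + u)"
      using g(2) h(1) by (simp add: e_def huw gw gl_add gu add.commute)
    then have Eu: "E u = u + w + D u" by (simp add: E_def algebra_simps)
    have "e w = w + u + g (D u)"
      using g(2) h(1) hV[OF u(3)] by (simp add: e_def huw gu gl_add gw)
    then have Ew: "E w = u + g (D u)" by (simp add: E_def algebra_simps)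
    have gDu: "g (D u) \<in> V i" using parabolicD(4)[OF g(1)] u(3) i by simp
    \<comment> \<open>\<open>T\<close> consists of the vectors with nonzero class in the plane
      spanned by u and w modulo \<open>V i\<close>. There E = e - 1 acts by u \<mapsto> u + w, w
      \<mapsto> u, with determinant -1; so E preserves \<open>T\<close> and no power of it kills
      u.\<close>
    define T where "T = {scale \<alpha> u + scale \<beta> w + b | \<alpha> \<beta> b. b \<in> V i \<and> (\<alpha> \<noteq> 0 \<or> \<beta> \<noteq> 0)}"
    have step: "E z \<in> T" if "z \<in> T" for z
    proof -
      obtain \<alpha> \<beta> b where z: "z = scale \<alpha> u + scale \<beta> w + b" "b \<in> V i" "\<alpha> \<noteq> 0 \<or> \<beta> \<noteq> 0"
        using \<open>z \<in> T\<close> by (auto simp: T_def)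
      define b' where "b' = scale \<alpha> (D u) + scale \<beta> (g (D u)) + E b"
      have "E b \<in> V i" unfolding E_def
        using z(2) parabolicD(4)[OF e] i subspace_diff[OF sV(1)] by simp
      then have "b' \<in> V i" unfolding b'_def
        using u(3) gDu subspace_add[OF sV(1)] subspace_scale[OF sV(1)] by simp
      moreover have "E z = scale (\<alpha> + \<beta>) u + scale \<alpha> w + b'"
        using E by (simp add: z(1) gl_add gl_scale Eu Ew b'_def algebra_simps)
      moreover have "\<alpha> + \<beta> \<noteq> 0 \<or> \<alpha> \<noteq> 0" using z(3) by auto
      ultimately show ?thesis unfolding T_def by blast
    qed
    have "u = scale 1 u + scale 0 w + 0 \<and> 0 \<in> V i \<and> ((1 :: 'k) \<noteq> 0 \<or> (0 :: 'k) \<noteq> 0)"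
      using subspace_0[OF sV(1)] by simp
    then have "u \<in> T" unfolding T_def by blast
    then have powT: "(E ^^ l) u \<in> T" for l by (induction l) (simp_all add: step)
    obtain l where "(E ^^ l) u = 0" using uni eN unfolding unipotent_def E_def by blast
    then have "0 \<in> T" using powT[of l] by simp
    then obtain \<alpha> \<beta> b where z: "0 = scale \<alpha> u + scale \<beta> w + b" "b \<in> V i" "\<alpha> \<noteq> 0 \<or> \<beta> \<noteq> 0"
      by (auto simp: T_def)
    then have "scale \<alpha> u + scale \<beta> w = - b" by (metis add_eq_0_iff2)
    then show False using coord z(2,3) subspace_neg[OF sV(1)] by metis
  qed
qed

lemma unipotent_radical_parabolic: "unipotent_radical parabolic = unipotent_part"
  unfolding unipotent_radical_def
proof (rule Greatest_equality)
  show "unipotent_part \<lhd> PG \<and> closedin (subtopology zariski (carrier GL)) unipotent_part \<and>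
      connectedin zariski unipotent_part \<and> (\<forall>g\<in>unipotent_part. unipotent g)"
    by (intro conjI ballI unipotent_part_normal unipotent_part_closed unipotent_part_connected
        unipotent_part_unipotent)
qed (elim conjE, rule normal_unipotent_le)

text \<open>If X v is not in \<open>V i\<close>, choose \<phi> vanishing on \<open>V i\<close> with
  \<phi> (X v) = 1: the function Y \<mapsto> \<phi> (Y v) - \<phi> v vanishes on the group but
  equals t at id + t X. Conversely, for lowering X the whole line id + t X stays in the group, so
  the polynomial 0 serves.\<close>

lemma lie_algebra_unipotent_part: "lie_algebra unipotent_part = lowering (length a) V"
proof (intro subset_antisym subsetI)
  fix X assume X: "X \<in> lie_algebra unipotent_part"
  then have gl: "X \<in> gl" by (simp add: lie_algebra_def)
  have "X v \<in> V i" if i: "i < length a" and v: "v \<in> V (Suc i)" for i v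
  proof (rule ccontr)
    assume "X v \<notin> V i"
    then obtain \<phi> where \<phi>: "Vector_Spaces.linear scale (*) \<phi>" "\<forall>w\<in>V i. \<phi> w = 0" "\<phi> (X v) = 1"
      using separating_form[OF subspace_V] i by (metis less_imp_le)
    interpret \<phi>: Vector_Spaces.linear scale "(*)" \<phi> by (fact \<phi>(1))
    let ?p = "\<lambda>Y. \<phi> (Y v) + - \<phi> v"
    have "?p \<in> regular" by (intro regular.add regular.coeff regular.const \<phi>(1))
    moreover have "\<forall>p\<in>regular. (\<forall>g\<in>unipotent_part. p g = 0) \<longrightarrow>
      (\<exists>q. (\<forall>t. poly q t = p (\<lambda>v. v + scale t (X v))) \<and> poly (pderiv q) 0 = 0)"
      using X by (simp add: lie_algebra_def)
    ultimately have "(\<forall>g\<in>unipotent_part. ?p g = 0) \<longrightarrow>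
      (\<exists>q. (\<forall>t. poly q t = ?p (\<lambda>v. v + scale t (X v))) \<and> poly (pderiv q) 0 = 0)"
      by (rule bspec[rotated])
    moreover have "?p g = 0" if "g \<in> unipotent_part" for g
      using unipotent_partD[OF that i v] \<phi>(2) \<phi>.diff[of "g v" v] by simp
    ultimately obtain q where q: "\<forall>t. poly q t = ?p (\<lambda>v. v + scale t (X v))" "poly (pderiv q) 0 = 0"
      by auto
    have "poly q = poly [:0, 1:]"
      using q(1) by (auto simp: fun_eq_iff \<phi>.add \<phi>.scale \<phi>(3))
    then have "q = [:0, 1:]" by (simp only: poly_eq_poly_eq_iff)
    then show False using q(2) by (simp add: pderiv_pCons)
  qed
  then show "X \<in> lowering (length a) V" using gl by (auto simp: lowering_def)
next
  fix X assume X: "X \<in> lowering (length a) V"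
  then have gl: "X \<in> gl" by (simp add: lowering_def)
  have "(\<lambda>v. v + scale t (X v)) \<in> unipotent_part" for t
  proof (rule unipotent_partI[OF gl_plus_id[OF gl]])
    fix i v assume i: "i < length a" "v \<in> V (Suc i)"
    then have "X v \<in> V i" using X by (auto simp: lowering_def)
    then show "v + scale t (X v) - v \<in> V i" using subspace_scale[OF subspace_V] i by simp
  qed
  then have "\<exists>q. (\<forall>t. poly q t = p (\<lambda>v. v + scale t (X v))) \<and> poly (pderiv q) 0 = 0"
    if "\<forall>g\<in>unipotent_part. p g = 0" for p
    using that by (intro exI[of _ 0]) auto
  then show "X \<in> lie_algebra unipotent_part" using gl by (auto simp: lie_algebra_def)
qed

lemma lie_algebra_unipotent_radical:
  "lie_algebra (unipotent_radical parabolic) = lowering (length a) V"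
  by (simp add: unipotent_radical_parabolic lie_algebra_unipotent_part)

end

section \<open>Semicontinuity of the rank\<close>

context fin_linear_group begin

lemma regular_sum: "finite I \<Longrightarrow> (\<And>i. i \<in> I \<Longrightarrow> p i \<in> regular) \<Longrightarrow> (\<lambda>X. \<Sum>i\<in>I. p i X) \<in> regular"
  by (induction I rule: finite_induct) (auto intro: regular.const regular.add)

lemma regular_prod: "finite I \<Longrightarrow> (\<And>i. i \<in> I \<Longrightarrow> p i \<in> regular) \<Longrightarrow> (\<lambda>X. \<Prod>i\<in>I. p i X) \<in> regular"
  by (induction I rule: finite_induct) (auto intro: regular.const regular.mult)

text \<open>Agreement is required only on \<open>gl\<close>: the type also contains nonlinear maps,
  for which the expansion of a power in a basis fails.\<close>

definition regular_map :: "(('v \<Rightarrow> 'v) \<Rightarrow> 'v) \<Rightarrow> bool" where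
  "regular_map f \<longleftrightarrow> (\<forall>\<phi>. Vector_Spaces.linear scale (*) \<phi> \<longrightarrow>
     (\<exists>p\<in>regular. \<forall>X\<in>gl. p X = \<phi> (f X)))"

lemma regular_mapD:
  assumes "regular_map f" "Vector_Spaces.linear scale (*) \<phi>"
  obtains p where "p \<in> regular" "\<forall>X\<in>gl. p X = \<phi> (f X)"
  using assms unfolding regular_map_def by blast

text \<open>Expanding X^k v in \<open>Basis\<close> before applying X once more gives a sum of
  products of regular coordinates with matrix coefficients.\<close>

lemma regular_map_funpow: "regular_map (\<lambda>X. (X ^^ k) v)"
proof (induction k)
  case 0
  show ?case unfolding regular_map_def by (auto intro!: bexI[OF _ regular.const])
next
  case (Suc k)
  show ?case unfolding regular_map_def
  proof (intro allI impI)
    fix \<phi> assume \<phi>: "Vector_Spaces.linear scale (*) \<phi>"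
    let ?r = "\<lambda>b w. representation Basis w b"
    have r: "Vector_Spaces.linear scale (*) (?r b)" for b
      by (rule linear_representation[OF independent_Basis span_Basis])
    have "\<forall>b. \<exists>p\<in>regular. \<forall>X\<in>gl. p X = ?r b ((X ^^ k) v)"
      using Suc r unfolding regular_map_def by blast
    then obtain p where p: "\<And>b. p b \<in> regular" "\<And>b X. X \<in> gl \<Longrightarrow> p b X = ?r b ((X ^^ k) v)"
      by metis
    let ?q = "\<lambda>X. \<Sum>b\<in>Basis. p b X * \<phi> (X b)"
    have "?q \<in> regular"
      using finite_Basis by (intro regular_sum regular.mult p(1) regular.coeff[OF \<phi>])
    moreover have "\<forall>X\<in>gl. ?q X = \<phi> ((X ^^ Suc k) v)"
    proof
      fix X assume X: "X \<in> gl"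
      have "(X ^^ k) v = (\<Sum>b\<in>Basis. scale (?r b ((X ^^ k) v)) b)"
        using sum_representation_eq[OF independent_Basis _ finite_Basis order_refl] by (simp add: span_Basis)
      then have "X ((X ^^ k) v) = X (\<Sum>b\<in>Basis. scale (?r b ((X ^^ k) v)) b)" by (rule arg_cong)
      also have "\<dots> = (\<Sum>b\<in>Basis. scale (?r b ((X ^^ k) v)) (X b))"
        using X by (simp add: gl_sum gl_scale)
      finally have "\<phi> (X ((X ^^ k) v)) = \<phi> (\<Sum>b\<in>Basis. scale (?r b ((X ^^ k) v)) (X b))"
        by (rule arg_cong)
      also have "\<dots> = (\<Sum>b\<in>Basis. ?r b ((X ^^ k) v) * \<phi> (X b))"
        by (simp add: form.linear_sum[OF \<phi>] form.linear_scale[OF \<phi>])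
      also have "\<dots> = ?q X" by (rule sum.cong) (simp_all only: p(2)[OF X])
      finally show "?q X = \<phi> ((X ^^ Suc k) v)" by (simp only: funpow.simps comp_apply)
    qed
    ultimately show "\<exists>p\<in>regular. \<forall>X\<in>gl. p X = \<phi> ((X ^^ Suc k) v)"
      by (intro bexI[where x = ?q])
  qed
qed

text \<open>Independence of an indexed family, not of a set: the vectors vary with \<open>X\<close>
  and could coincide, which a set would not register.\<close>

definition independent_family :: "nat \<Rightarrow> (nat \<Rightarrow> 'v) \<Rightarrow> bool" where
  "independent_family m e \<longleftrightarrow> (\<forall>c. (\<Sum>i<m. scale (c i) (e i)) = 0 \<longrightarrow> (\<forall>i<m. c i = 0))"

lemma independent_familyD:
  "independent_family m e \<Longrightarrow> (\<Sum>i<m. scale (c i) (e i)) = 0 \<Longrightarrow> i < m \<Longrightarrow> c i = 0"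
  by (simp add: independent_family_def)

lemma independent_family_inj:
  assumes "independent_family m e"
  shows "inj_on e {..<m}"
proof (rule inj_onI, rule ccontr)
  fix i j assume ij: "i \<in> {..<m}" "j \<in> {..<m}" "e i = e j" "i \<noteq> j"
  let ?c = "\<lambda>k. (if k = i then 1 else 0) - (if k = j then 1 else 0) :: 'k"
  have "(\<Sum>k<m. scale (?c k) (e k)) = (\<Sum>k<m. if k = i then e k else 0) - (\<Sum>k<m. if k = j then e k else 0)"
    unfolding sum_subtractf[symmetric] by (intro sum.cong) auto
  also have "\<dots> = 0" using ij by simp
  finally have "?c i = 0" using ij(1) by (intro independent_familyD[OF assms, of ?c]) auto
  then show False using ij by simp
qed

lemma independent_family_iff:
  "independent_family m e \<longleftrightarrow> inj_on e {..<m} \<and> independent (e ` {..<m})"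
proof
  assume e: "independent_family m e"
  note inj = independent_family_inj[OF e]
  have "u b = 0" if "(\<Sum>b\<in>e ` {..<m}. scale (u b) b) = 0" "b \<in> e ` {..<m}" for u b
    using that e unfolding sum.reindex[OF inj] independent_family_def by auto
  then show "inj_on e {..<m} \<and> independent (e ` {..<m})"
    using inj by (auto simp: independent_explicit)
next
  assume e: "inj_on e {..<m} \<and> independent (e ` {..<m})"
  have "c i = 0" if "(\<Sum>i<m. scale (c i) (e i)) = 0" "i < m" for c i
  proof -
    have "(\<Sum>b\<in>e ` {..<m}. scale (c (inv_into {..<m} e b)) b) = 0"
      using e that(1) by (simp add: sum.reindex)
    then have "c (inv_into {..<m} e (e i)) = 0"
      using e that(2) unfolding independent_explicit
      by (elim conjE allE[where x = "\<lambda>b. c (inv_into {..<m} e b)"] impE) auto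
    then show ?thesis using e that(2) by simp
  qed
  then show "independent_family m e" by (simp add: independent_family_def)
qed

text \<open>One step of Gaussian elimination, with the denominators cleared so that the family stays
  regular.\<close>

lemma independent_family_eliminate:
  assumes \<phi>: "Vector_Spaces.linear scale (*) \<phi>" and "\<phi> (e m) \<noteq> 0"
  shows "independent_family (Suc m) e \<longleftrightarrow>
    independent_family m (\<lambda>i. scale (\<phi> (e m)) (e i) - scale (\<phi> (e i)) (e m))"
proof -
  interpret \<phi>: Vector_Spaces.linear scale "(*)" \<phi> by (fact \<phi>)
  let ?e = "\<lambda>i. scale (\<phi> (e m)) (e i) - scale (\<phi> (e i)) (e m)"
  have eq: "(\<Sum>i<m. scale (c i) (?e i)) =
    scale (\<phi> (e m)) (\<Sum>i<m. scale (c i) (e i)) - scale (\<phi> (\<Sum>i<m. scale (c i) (e i))) (e m)" for c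
    by (simp add: scale_right_diff_distrib sum_subtractf scale_sum_right scale_sum_left \<phi>.sum
        \<phi>.scale mult.commute)
  show ?thesis
  proof
    assume e: "independent_family (Suc m) e"
    show "independent_family m ?e"
      unfolding independent_family_def
    proof (intro allI impI)
      fix c i assume c: "(\<Sum>i<m. scale (c i) (?e i)) = 0" and "i < m"
      let ?c = "\<lambda>i. if i < m then \<phi> (e m) * c i else - \<phi> (\<Sum>i<m. scale (c i) (e i))"
      have "(\<Sum>i<Suc m. scale (?c i) (e i)) = (\<Sum>i<m. scale (c i) (?e i))"
        unfolding eq by (simp add: scale_sum_right)
      then have "(\<Sum>i<Suc m. scale (?c i) (e i)) = 0" using c by (rule trans)
      then have "?c i = 0" using \<open>i < m\<close> by (intro independent_familyD[OF e, of ?c]) auto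
      then show "c i = 0" using assms \<open>i < m\<close> by simp
    qed
  next
    assume e: "independent_family m ?e"
    show "independent_family (Suc m) e"
      unfolding independent_family_def
    proof (intro allI impI)
      fix c i assume "(\<Sum>i<Suc m. scale (c i) (e i)) = 0" and "i < Suc m"
      then have c: "(\<Sum>i<m. scale (c i) (e i)) = scale (- c m) (e m)"
        by (simp add: add_eq_0_iff2)
      then have "(\<Sum>i<m. scale (c i) (?e i)) = 0"
        unfolding eq by (simp add: \<phi>.scale \<phi>.neg mult.commute)
      then have c0: "\<forall>i<m. c i = 0" using e by (simp add: independent_family_def)
      then have "scale (c m) (e m) = 0" using c by simp
      moreover have "e m \<noteq> 0" using assms(2) by auto
      ultimately show "c i = 0" using c0 \<open>i < Suc m\<close> by (auto simp: less_Suc_eq)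
    qed
  qed
qed

text \<open>Elimination replaces minors. A form \<phi> with value 1 on the last vector at
  \<open>X0\<close> provides a pivot; the sought function is the pivot \<phi> (f m X) times the
  function obtained for the \<open>m\<close> eliminated vectors.\<close>

lemma independent_family_open:
  assumes "\<forall>i<m. regular_map (f i)" "X0 \<in> gl" "independent_family m (\<lambda>i. f i X0)"
  shows "\<exists>p\<in>regular. p X0 \<noteq> 0 \<and> (\<forall>X\<in>gl. p X \<noteq> 0 \<longrightarrow> independent_family m (\<lambda>i. f i X))"
  using assms
proof (induction m arbitrary: f)
  case 0
  show ?case by (rule bexI[OF _ regular.const[of 1]]) (simp add: independent_family_def)
next
  case (Suc m)
  have "f m X0 \<notin> {0}"
  proof
    assume "f m X0 \<in> {0}"
    then have "(\<Sum>i<Suc m. scale (if i = m then 1 else 0) (f i X0)) = 0" by simp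
    then have "(if m = m then 1 else 0 :: 'k) = 0"
      by (intro independent_familyD[OF Suc.prems(3), of "\<lambda>i. if i = m then 1 else 0"]) auto
    then show False by simp
  qed
  then obtain \<phi> where \<phi>: "Vector_Spaces.linear scale (*) \<phi>" "\<phi> (f m X0) = 1"
    using separating_form[of "{0}"] by (metis subspace_single_0)
  let ?f = "\<lambda>i X. scale (\<phi> (f m X)) (f i X) - scale (\<phi> (f i X)) (f m X)"
  have "regular_map (?f i)" if "i < m" for i
    unfolding regular_map_def
  proof (intro allI impI)
    fix \<psi> assume \<psi>: "Vector_Spaces.linear scale (*) \<psi>"
    have reg: "regular_map (f i)" "regular_map (f m)" using Suc.prems(1) that by auto
    obtain p1 where p1: "p1 \<in> regular" "\<forall>X\<in>gl. p1 X = \<phi> (f m X)" using reg(2) \<phi>(1) by (rule regular_mapD)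
    obtain p2 where p2: "p2 \<in> regular" "\<forall>X\<in>gl. p2 X = \<psi> (f i X)" using reg(1) \<psi> by (rule regular_mapD)
    obtain p3 where p3: "p3 \<in> regular" "\<forall>X\<in>gl. p3 X = \<phi> (f i X)" using reg(1) \<phi>(1) by (rule regular_mapD)
    obtain p4 where p4: "p4 \<in> regular" "\<forall>X\<in>gl. p4 X = \<psi> (f m X)" using reg(2) \<psi> by (rule regular_mapD)
    have "(\<lambda>X. p1 X * p2 X + (- 1) * (p3 X * p4 X)) \<in> regular"
      by (intro regular.add regular.mult regular.const p1(1) p2(1) p3(1) p4(1))
    moreover have "\<forall>X\<in>gl. p1 X * p2 X + (- 1) * (p3 X * p4 X) = \<psi> (?f i X)"
      using p1(2) p2(2) p3(2) p4(2) by (simp add: form.linear_diff[OF \<psi>] form.linear_scale[OF \<psi>])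
    ultimately show "\<exists>p\<in>regular. \<forall>X\<in>gl. p X = \<psi> (?f i X)"
      by (intro bexI[where x = "\<lambda>X. p1 X * p2 X + (- 1) * (p3 X * p4 X)"])
  qed
  moreover have "independent_family m (\<lambda>i. ?f i X0)"
    using Suc.prems(3) independent_family_eliminate[OF \<phi>(1), of "\<lambda>i. f i X0" m] \<phi>(2) by simp
  ultimately obtain p where p: "p \<in> regular" "p X0 \<noteq> 0"
    "\<forall>X\<in>gl. p X \<noteq> 0 \<longrightarrow> independent_family m (\<lambda>i. ?f i X)"
    using Suc.IH[of ?f] Suc.prems(2) by blast
  have "regular_map (f m)" using Suc.prems(1) by simp
  then obtain q where q: "q \<in> regular" "\<forall>X\<in>gl. q X = \<phi> (f m X)" using \<phi>(1) by (rule regular_mapD)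
  have "(\<lambda>X. p X * q X) \<in> regular" using p(1) q(1) by (rule regular.mult)
  moreover have "p X0 * q X0 \<noteq> 0" using p(2) q(2) \<phi>(2) Suc.prems(2) by simp
  moreover have "independent_family (Suc m) (\<lambda>i. f i X)" if "X \<in> gl" "p X * q X \<noteq> 0" for X
    using that p(3) q(2) independent_family_eliminate[OF \<phi>(1), of "\<lambda>i. f i X" m] by auto
  ultimately show ?case by (intro bexI[where x = "\<lambda>X. p X * q X"]) auto
qed

text \<open>Fix preimages of a basis of the image of X0^k. Wherever \<open>p\<close> does not
  vanish, X^k sends these same vectors to an independent family.\<close>

lemma rank_semicontinuous:
  assumes X0: "X0 \<in> gl"
  shows "\<exists>p\<in>regular. p X0 \<noteq> 0 \<and>
    (\<forall>X\<in>gl. p X \<noteq> 0 \<longrightarrow> dim ((X0 ^^ k) ` UNIV) \<le> dim ((X ^^ k) ` UNIV))"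
proof -
  obtain B where B: "finite B" "B \<subseteq> (X0 ^^ k) ` UNIV" "independent B" "card B = dim ((X0 ^^ k) ` UNIV)"
    using basis_subspace_exists[OF subspace_image_gl[OF gl_funpow[OF X0] subspace_UNIV]] by metis
  define m where "m = card B"
  obtain e where e: "bij_betw e {..<m} B"
    using ex_bij_betw_nat_finite[OF B(1)] by (auto simp: lessThan_atLeast0 m_def)
  have "\<forall>i. \<exists>v. i < m \<longrightarrow> (X0 ^^ k) v = e i"
    using e B(2) by (metis (no_types, lifting) bij_betw_apply imageE lessThan_iff subsetD)
  then obtain v where v: "\<And>i. i < m \<Longrightarrow> (X0 ^^ k) (v i) = e i" by metis
  have "(\<lambda>i. (X0 ^^ k) (v i)) ` {..<m} = B" "inj_on (\<lambda>i. (X0 ^^ k) (v i)) {..<m}"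
    using e v by (auto simp: bij_betw_def inj_on_def)
  then have "independent_family m (\<lambda>i. (X0 ^^ k) (v i))"
    using B(3) by (simp add: independent_family_iff)
  then obtain p where p: "p \<in> regular" "p X0 \<noteq> 0"
    "\<forall>X\<in>gl. p X \<noteq> 0 \<longrightarrow> independent_family m (\<lambda>i. (X ^^ k) (v i))"
    using independent_family_open[of m "\<lambda>i X. (X ^^ k) (v i)", OF _ X0] regular_map_funpow by blast
  have "dim ((X0 ^^ k) ` UNIV) \<le> dim ((X ^^ k) ` UNIV)" if X: "X \<in> gl" "p X \<noteq> 0" for X
  proof -
    have f: "inj_on (\<lambda>i. (X ^^ k) (v i)) {..<m}" "independent ((\<lambda>i. (X ^^ k) (v i)) ` {..<m})"
      using p(3) X by (simp_all add: independent_family_iff)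
    have "card ((\<lambda>i. (X ^^ k) (v i)) ` {..<m}) \<le> dim ((X ^^ k) ` UNIV)"
      by (rule independent_card_le_dim[OF _ f(2)]) auto
    then show ?thesis using card_image[OF f(1)] B(4) by (simp add: m_def)
  qed
  then show ?thesis using p by blast
qed

section \<open>Conjugacy classes described by ranks of powers\<close>

lemma dim_Ad_funpow:
  assumes g: "g \<in> carrier GL" and X: "X \<in> gl"
  shows "dim ((Ad g X ^^ k) ` UNIV) = dim ((X ^^ k) ` UNIV)"
proof -
  have gl: "g \<in> gl" "bij g" using g by (auto simp: GL_carrier)
  have "(Ad g X ^^ k) (g v) = g ((X ^^ k) v)" for v
    using Ad_eq_iff[OF g, of X "Ad g X"] by (induction k) auto
  then have "(Ad g X ^^ k) ` g ` UNIV = g ` (X ^^ k) ` UNIV" by (simp add: image_image)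
  then have "(Ad g X ^^ k) ` UNIV = g ` (X ^^ k) ` UNIV" using gl(2) by (simp add: bij_is_surj)
  then show ?thesis
    using dim_image_gl_eq[OF gl(1) subspace_image_gl[OF gl_funpow[OF X] subspace_UNIV]]
      inj_on_subset[OF bij_is_inj[OF gl(2)]] by simp
qed

lemma conjugate_if_equal_ranks:
  assumes "X \<in> gl" "Y \<in> gl" "\<And>k. dim ((X ^^ k) ` UNIV) = dim ((Y ^^ k) ` UNIV)" "\<And>v. (X ^^ n) v = 0"
  shows "\<exists>g\<in>carrier GL. Y = Ad g X"
proof -
  obtain g where g: "g \<in> gl" "inj_on g UNIV" "g ` UNIV = UNIV" "\<forall>u\<in>UNIV. g (X u) = Y (g u)"
    using nilpotent_conjugate[OF assms(1,2) subspace_UNIV subspace_UNIV, of n] assms(3,4) by auto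
  then have "g \<in> carrier GL" by (simp add: GL_carrier bij_def)
  then show ?thesis using g(4) Ad_eq_iff by (metis UNIV_I)
qed

lemma filtration_dim: "filtration a V \<Longrightarrow> dim (V (length a)) = sum_list a"
proof (induction a rule: rev_induct)
  case Nil
  then show ?case by (simp add: filtration_def)
qed (auto simp: filtration_snoc)

text \<open>Nilpotency is built in, since the prescribed rank is 0 from exponent
  \<open>length a\<close> on. The cut-off dim V bounds the entries of every composition of dim V, so
  different compositions can share it.\<close>

definition nilpotents_of_type :: "nat list \<Rightarrow> ('v \<Rightarrow> 'v) set" where
  "nilpotents_of_type a =
    {X \<in> gl. \<forall>k. dim ((X ^^ k) ` UNIV) = richardson_rank (dim (UNIV :: 'v set)) a k}"

end

section \<open>Richardson orbits\<close>

context flag begin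

lemma part_le_dim: "\<forall>x\<in>set a. x \<le> dim (UNIV :: 'v set)"
  using filtration_dim[OF filtration] top member_le_sum_list[of _ a] by simp

definition richardson_elements :: "('v \<Rightarrow> 'v) set" where
  "richardson_elements = lowering (length a) V \<inter> nilpotents_of_type a"

lemma richardson_elements_nonempty: "richardson_elements \<noteq> {}"
  using exists_richardson_element[OF filtration part_le_dim]
  by (auto simp: richardson_elements_def nilpotents_of_type_def lowering_def top)

lemma richardson_elements_open:
  "openin (subtopology zariski (lowering (length a) V)) richardson_elements"
proof -
  let ?n = "lowering (length a) V"
  define S where "S = {p \<in> regular. \<forall>X\<in>?n. p X \<noteq> 0 \<longrightarrow> X \<in> richardson_elements}"
  have n: "?n \<subseteq> gl" by (auto simp: lowering_def)
  have "\<exists>p\<in>S. p X \<noteq> 0" if X: "X \<in> richardson_elements" for X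
  proof -
    have gl: "X \<in> gl" and rk: "\<And>k. dim ((X ^^ k) ` UNIV) = richardson_rank (dim (UNIV :: 'v set)) a k"
      using X by (simp_all add: richardson_elements_def nilpotents_of_type_def)
    have "\<forall>k. \<exists>p\<in>regular. p X \<noteq> 0 \<and>
      (\<forall>Y\<in>gl. p Y \<noteq> 0 \<longrightarrow> dim ((X ^^ k) ` UNIV) \<le> dim ((Y ^^ k) ` UNIV))"
      using rank_semicontinuous[OF gl] by blast
    then obtain p where p: "\<And>k. p k \<in> regular" "\<And>k. p k X \<noteq> 0"
      "\<And>k Y. Y \<in> gl \<Longrightarrow> p k Y \<noteq> 0 \<Longrightarrow> dim ((X ^^ k) ` UNIV) \<le> dim ((Y ^^ k) ` UNIV)" by metis
    \<comment> \<open>Finitely many exponents suffice: from \<open>length a\<close> on the required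
      rank is 0. On the lowering endomorphisms the upper bound holds everywhere, so only the lower
      one has to be forced by nonvanishing.\<close>
    let ?p = "\<lambda>Y. \<Prod>k<length a. p k Y"
    have "?p \<in> regular" by (intro regular_prod p(1)) simp
    moreover have "Y \<in> richardson_elements" if Y: "Y \<in> ?n" "?p Y \<noteq> 0" for Y
    proof -
      have "dim ((Y ^^ k) ` UNIV) = richardson_rank (dim (UNIV :: 'v set)) a k" for k
      proof (rule order_antisym)
        show "dim ((Y ^^ k) ` UNIV) \<le> richardson_rank (dim (UNIV :: 'v set)) a k"
          using lowering_rank_le[OF filtration Y(1) part_le_dim] by (simp add: top)
        show "richardson_rank (dim (UNIV :: 'v set)) a k \<le> dim ((Y ^^ k) ` UNIV)"
          using p(3)[of Y k] Y n rk[of k] richardson_rank_large[of a k] by (cases "k < length a") auto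
      qed
      then show ?thesis using Y n by (auto simp: richardson_elements_def nilpotents_of_type_def)
    qed
    ultimately have "?p \<in> S" by (simp add: S_def)
    moreover have "?p X \<noteq> 0" using p(2) by simp
    ultimately show ?thesis by (intro bexI[where x = ?p])
  qed
  then have "richardson_elements = {X \<in> gl. \<exists>p\<in>S. p X \<noteq> 0} \<inter> ?n"
    using n by (auto simp: S_def richardson_elements_def)
  moreover have "openin zariski {X \<in> gl. \<exists>p\<in>S. p X \<noteq> 0}"
    unfolding openin_zariski zariski_open_def by (intro exI[of _ S]) (auto simp: S_def)
  ultimately show ?thesis unfolding openin_subtopology by blast
qed

lemma Ad_lowering:
  assumes "g \<in> parabolic" "X \<in> lowering (length a) V"
  shows "Ad g X \<in> lowering (length a) V"
proof -
  have "Ad g X v \<in> V i" if i: "i < length a" "v \<in> V (Suc i)" for i v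
  proof -
    obtain w where w: "w \<in> V (Suc i)" "v = g w"
    proof -
      have "g ` V (Suc i) = V (Suc i)" using assms(1) i(1) by (simp add: parabolic_def)
      then show thesis using i(2) that by blast
    qed
    then have "Ad g X v = g (X w)" using Ad_eq_iff[of g X "Ad g X"] parabolicD(1)[OF assms(1)] by simp
    moreover have "X w \<in> V i" using assms(2) w i by (auto simp: lowering_def)
    ultimately show ?thesis using parabolicD(4)[OF assms(1)] i by simp
  qed
  moreover have "Ad g X \<in> gl" using assms Ad_gl parabolicD(1) by (auto simp: lowering_def)
  ultimately show ?thesis by (auto simp: lowering_def)
qed

lemma richardson_elements_orbit:
  assumes X: "X \<in> richardson_elements"
  shows "richardson_elements = {Ad g X | g. g \<in> parabolic}"
proof (intro subset_antisym subsetI)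
  have low: "X \<in> lowering (length a) V" and gl: "X \<in> gl"
    and rk: "\<And>k. dim ((X ^^ k) ` UNIV) = richardson_rank (dim (UNIV :: 'v set)) a k"
    using X by (auto simp: richardson_elements_def nilpotents_of_type_def)
  {
    fix Y assume "Y \<in> {Ad g X | g. g \<in> parabolic}"
    then obtain g where g: "g \<in> parabolic" "Y = Ad g X" by blast
    then show "Y \<in> richardson_elements"
      using Ad_lowering[OF g(1) low] Ad_gl[OF parabolicD(1)[OF g(1)] gl]
        dim_Ad_funpow[OF parabolicD(1)[OF g(1)] gl] rk
      by (simp add: richardson_elements_def nilpotents_of_type_def)
  next
    fix Y assume "Y \<in> richardson_elements"
    then have Y: "Y \<in> lowering (length a) V" "Y \<in> gl"
      "\<And>k. dim ((Y ^^ k) ` UNIV) = richardson_rank (dim (UNIV :: 'v set)) a k"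
      by (auto simp: richardson_elements_def nilpotents_of_type_def)
    then obtain g where g: "g \<in> carrier GL" "Y = Ad g X"
      using conjugate_if_equal_ranks[OF gl Y(2), of "length a"] rk lowering_nilpotent[OF low] by auto
    then have gl_g: "g \<in> gl" "inj g" "surj g" by (auto simp: GL_carrier bij_def)
    have Yg: "Y (g v) = g (X v)" for v using Ad_eq_iff[OF g(1)] g(2) by metis
    have dim_g: "dim (g ` V i) = dim (V i)" if "i \<le> length a" for i
      using dim_image_gl_eq[OF gl_g(1) subspace_V[OF that]] inj_on_subset[OF gl_g(2)] by simp
    \<comment> \<open>Y = Ad g X lowers both the translated flag g V and V itself; uniqueness of the
      lowered flag then puts g in the stabilizer.\<close>
    have gV: "filtration a (\<lambda>i. g ` V i)"
      using filtration gl_g(1) dim_g subspace_image_gl[OF gl_g(1) subspace_V]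
      unfolding filtration_def by (auto intro!: image_mono simp: Suc_le_eq)
    have "Y \<in> lowering (length a) (\<lambda>i. g ` V i)"
      using Y(2) loweringD[OF low] by (auto simp: lowering_def Yg)
    then have "g ` V i = V i" if "i \<le> length a" for i
      using filtration_unique[OF gV filtration _ Y(1) part_le_dim] Y(3) that gl_g(3) by (simp add: top)
    then show "Y \<in> {Ad g X | g. g \<in> parabolic}" using g by (auto simp: parabolic_def)
  }
qed

lemma lowering_line:
  assumes "A \<in> lowering s V" "B \<in> lowering s V" "s \<le> length a"
  shows "(\<lambda>v. A v + scale t (B v - A v)) \<in> lowering s V"
proof -
  have gl: "A \<in> gl" "B \<in> gl" using assms by (auto simp: lowering_def)
  have "(\<lambda>v. A v + scale t (B v - A v)) \<in> gl"
    by (rule glI) (simp_all add: gl gl_add gl_scale algebra_simps)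
  moreover have "A v + scale t (B v - A v) \<in> V i" if "i < s" "v \<in> V (Suc i)" for i v
  proof -
    have AB: "A v \<in> V i" "B v \<in> V i" using loweringD assms that by blast+
    have V: "subspace (V i)" using assms(3) that subspace_V by simp
    show ?thesis by (rule subspace_add[OF V AB(1) subspace_scale[OF V subspace_diff[OF V AB(2,1)]]])
  qed
  ultimately show ?thesis by (auto simp: lowering_def)
qed

lemma richardson_orbit_parabolic: "richardson_orbit parabolic = richardson_elements"
  unfolding richardson_orbit_def Let_def lie_algebra_unipotent_radical
proof (rule the_equality)
  let ?n = "lowering (length a) V"
  obtain X where X: "X \<in> richardson_elements" using richardson_elements_nonempty by blast
  then have "X \<in> ?n" by (simp add: richardson_elements_def)
  then show "(\<exists>X\<in>?n. richardson_elements = {Ad g X | g. g \<in> parabolic}) \<and>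
      openin (subtopology zariski ?n) richardson_elements"
    using richardson_elements_orbit[OF X] richardson_elements_open by blast
  fix \<O> assume "(\<exists>X\<in>?n. \<O> = {Ad g X | g. g \<in> parabolic}) \<and> openin (subtopology zariski ?n) \<O>"
  then obtain Y where Y: "Y \<in> ?n" "\<O> = {Ad g Y | g. g \<in> parabolic}"
    and \<O>: "openin (subtopology zariski ?n) \<O>" by blast
  obtain U where U: "openin zariski U" "\<O> = U \<inter> ?n" using \<O> by (auto simp: openin_subtopology)
  obtain W where W: "openin zariski W" "richardson_elements = W \<inter> ?n"
    using richardson_elements_open by (auto simp: openin_subtopology)
  have "Y \<in> \<O>" using Y(2) parabolic_id Ad_id by force
  \<comment> \<open>Two nonempty open subsets meet; through a common point Z, both \<O> and
    \<open>richardson_elements\<close> are the parabolic orbit of Z.\<close>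
  have "?n \<inter> U \<inter> W \<noteq> {}"
  proof (rule affine_irreducible)
    show "?n \<subseteq> gl" by (auto simp: lowering_def)
    show "?n \<inter> U \<noteq> {}" using \<open>Y \<in> \<O>\<close> U by blast
    show "?n \<inter> W \<noteq> {}" using X W by blast
  qed (use U W lowering_line in auto)
  then obtain Z where Z: "Z \<in> \<O>" "Z \<in> richardson_elements" using U W by blast
  obtain h where h: "h \<in> parabolic" "Z = Ad h Y" using Z Y by blast
  let ?h = "inv_into UNIV h"
  have h': "?h \<in> parabolic" by (rule parabolic_inv[OF h(1)])
  have "?h \<circ> h = id" using parabolicD(3)[OF h(1)] by (simp add: bij_is_inj)
  then have YZ: "Y = Ad ?h Z"
    using Ad_comp[OF parabolicD(1)[OF h'] parabolicD(1)[OF h(1)], of Y] h(2) by (simp add: Ad_id)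
  have "\<O> = {Ad g Z | g. g \<in> parabolic}"
  proof (intro subset_antisym subsetI)
    fix T assume "T \<in> \<O>"
    then obtain g where g: "g \<in> parabolic" "T = Ad g (Ad ?h Z)" using Y(2) YZ by blast
    then have "T = Ad (g \<circ> ?h) Z" using Ad_comp parabolicD(1) h' by simp
    then show "T \<in> {Ad g Z | g. g \<in> parabolic}" using parabolic_comp[OF g(1) h'] by blast
  next
    fix T assume "T \<in> {Ad g Z | g. g \<in> parabolic}"
    then obtain g where g: "g \<in> parabolic" "T = Ad g (Ad h Y)" using h(2) by blast
    then have "T = Ad (g \<circ> h) Y" using Ad_comp parabolicD(1) h(1) by simp
    then show "T \<in> \<O>" using parabolic_comp[OF g(1) h(1)] Y(2) by blast
  qed
  then show "\<O> = richardson_elements" using richardson_elements_orbit[OF Z(2)] by simp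
qed

end

section \<open>Nil-equivalence of flag varieties\<close>

context fin_linear_group begin

lemma flag_of_Fl:
  assumes "F \<in> Fl a"
  shows "flag scale Basis a (\<lambda>i. ({0} # F) ! i)"
    and "stabilizer F = flag.parabolic scale a (\<lambda>i. ({0} # F) ! i)"
proof -
  have F: "length F = length a" "\<forall>W\<in>set F. subspace W" "last ({0} # F) = UNIV"
    "\<forall>i<length a. ({0} # F) ! i \<subseteq> ({0} # F) ! Suc i \<and>
        dim (({0} # F) ! Suc i) = dim (({0} # F) ! i) + a ! i"
    using assms by (simp_all add: Fl_def)
  have "filtration a (\<lambda>i. ({0} # F) ! i)"
    unfolding filtration_def using F by simp
  moreover have "({0} # F) ! length a = UNIV"
    using F(1,3) last_conv_nth[of "{0} # F"] by simp
  ultimately show fl: "flag scale Basis a (\<lambda>i. ({0} # F) ! i)"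
    by unfold_locales
  interpret flag scale Basis a "\<lambda>i. ({0} # F) ! i" by (fact fl)
  have "map (image g) F = F \<longleftrightarrow> (\<forall>i\<le>length a. g ` (({0} # F) ! i) = ({0} # F) ! i)"
    if "g \<in> carrier GL" for g
  proof -
    have "g 0 = 0" using that by (simp add: GL_carrier)
    have "map (image g) F = F \<longleftrightarrow> (\<forall>i<length a. g ` (F ! i) = F ! i)"
      using F(1) by (simp add: list_eq_iff_nth_eq)
    also have "\<dots> \<longleftrightarrow> (\<forall>i\<le>length a. g ` (({0} # F) ! i) = ({0} # F) ! i)"
      using \<open>g 0 = 0\<close> by (auto simp: nth_Cons Suc_le_eq split: nat.splits)
    finally show ?thesis .
  qed
  then show "stabilizer F = parabolic"
    unfolding stabilizer_def parabolic_def by blast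
qed

text \<open>The inequality, in place of an equality, passes to prefixes of \<open>a\<close> and so
  carries the induction.\<close>

lemma exists_filtration:
  "sum_list a \<le> dim (UNIV :: 'v set) \<Longrightarrow> \<exists>V. filtration a V"
proof (induction a rule: rev_induct)
  case Nil
  show ?case by (intro exI[of _ "\<lambda>_. {0}"]) (simp add: filtration_def)
next
  case (snoc c a)
  then obtain V where V: "filtration a V" by auto
  let ?W = "V (length a)"
  obtain B where B: "B \<subseteq> ?W" "independent B" "span B = ?W" "card B = dim ?W"
    using basis_subspace_exists[OF filtration_subspace[OF V order_refl]] by metis
  obtain C where C: "B \<subseteq> C" "independent C" "span C = UNIV"
    using extend_basis_subspace[OF subspace_UNIV B(2)] by auto
  have fin: "finite B" "finite C" using B C finiteI_independent by auto
  have "card C = dim (UNIV :: 'v set)" using C by (metis dim_span_eq_card_independent)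
  moreover have "card (C - B) = card C - card B" using C(1) fin by (simp add: card_Diff_subset)
  ultimately have "c \<le> card (C - B)"
    using snoc.prems filtration_dim[OF V] B(4) by simp
  then obtain D where D: "D \<subseteq> C - B" "card D = c" "finite D"
    by (metis obtain_subset_with_card_n)
  have "independent (B \<union> D)" using C D by (intro independent_mono[OF C(2)]) auto
  then have "dim (span (B \<union> D)) = card (B \<union> D)" by (rule dim_span_eq_card_independent)
  also have "\<dots> = dim ?W + c" using B(4) D fin by (subst card_Un_disjoint) auto
  finally have "dim (span (B \<union> D)) = dim ?W + c" .
  moreover have "?W \<subseteq> span (B \<union> D)" using span_mono[of B "B \<union> D"] B(3) by auto
  moreover have "filtration a (V(Suc (length a) := span (B \<union> D)))"
    using V unfolding filtration_def by auto
  ultimately have "filtration (a @ [c]) (V(Suc (length a) := span (B \<union> D)))"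
    by (simp add: filtration_snoc)
  then show ?case by blast
qed

text \<open>Ensures that the union defining \<open>nil_variety\<close> runs over at least one
  flag.\<close>

lemma Fl_nonempty:
  assumes "sum_list a = dim (UNIV :: 'v set)"
  shows "Fl a \<noteq> {}"
proof -
  obtain V where V: "filtration a V" using exists_filtration[of a] assms by auto
  have "V (length a) = UNIV"
    using filtration_dim[OF V] assms filtration_subspace[OF V] subspace_UNIV
    by (intro subspace_dim_equal) auto
  let ?F = "map (\<lambda>i. V (Suc i)) [0..<length a]"
  have nth: "({0} # ?F) ! i = V i" if "i \<le> length a" for i
    using that V by (cases i) (auto simp: filtration_def)
  have "last ({0} # ?F) = ({0} # ?F) ! length a" using last_conv_nth[of "{0} # ?F"] by simp
  then have "last ({0} # ?F) = UNIV" using nth \<open>V (length a) = UNIV\<close> by simp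
  moreover have "\<forall>i<length a. ({0} # ?F) ! i \<subseteq> ({0} # ?F) ! Suc i \<and>
      dim (({0} # ?F) ! Suc i) = dim (({0} # ?F) ! i) + a ! i"
    using V nth by (simp add: filtration_def Suc_le_eq del: nth_Cons_Suc)
  moreover have "\<forall>W\<in>set ?F. subspace W" using V by (auto simp: filtration_def)
  ultimately have "?F \<in> Fl a" by (simp add: Fl_def)
  then show ?thesis by blast
qed

text \<open>Conjugation preserves ranks, so every flag contributes only elements of the type. One
  Richardson element of one flag already reaches all of them, because equal ranks imply
  conjugacy.\<close>

lemma nil_variety_Fl:
  assumes "sum_list a = dim (UNIV :: 'v set)"
  shows "nil_variety (Fl a) = nilpotents_of_type a" and "nilpotents_of_type a \<noteq> {}"
proof -
  have orbit: "richardson_orbit (stabilizer F) = lowering (length a) (\<lambda>i. ({0} # F) ! i) \<inter> nilpotents_of_type a"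
    "richardson_orbit (stabilizer F) \<noteq> {}" if "F \<in> Fl a" for F
  proof -
    interpret flag scale Basis a "\<lambda>i. ({0} # F) ! i" by (rule flag_of_Fl(1)[OF that])
    show "richardson_orbit (stabilizer F) = lowering (length a) (\<lambda>i. ({0} # F) ! i) \<inter> nilpotents_of_type a"
      "richardson_orbit (stabilizer F) \<noteq> {}"
      using flag_of_Fl(2)[OF that] richardson_orbit_parabolic richardson_elements_nonempty
      by (simp_all add: richardson_elements_def)
  qed
  obtain F where F: "F \<in> Fl a" using Fl_nonempty[OF assms] by blast
  obtain X where X: "X \<in> richardson_orbit (stabilizer F)" using orbit(2)[OF F] by blast
  then have XT: "X \<in> nilpotents_of_type a" and low: "X \<in> lowering (length a) (\<lambda>i. ({0} # F) ! i)"
    using orbit(1)[OF F] by auto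
  show "nilpotents_of_type a \<noteq> {}" using XT by blast
  have nil: "(X ^^ length a) v = 0" for v
  proof -
    interpret flag scale Basis a "\<lambda>i. ({0} # F) ! i" by (rule flag_of_Fl(1)[OF F])
    show ?thesis by (rule lowering_nilpotent[OF low])
  qed
  show "nil_variety (Fl a) = nilpotents_of_type a"
  proof (intro subset_antisym subsetI)
    fix Z assume "Z \<in> nil_variety (Fl a)"
    then obtain F' g Y where "F' \<in> Fl a" "g \<in> carrier GL" "Y \<in> richardson_orbit (stabilizer F')" "Z = Ad g Y"
      unfolding nil_variety_def by blast
    then show "Z \<in> nilpotents_of_type a"
      using orbit(1)[of F'] Ad_gl[of g Y] dim_Ad_funpow[of g Y] by (simp add: nilpotents_of_type_def)
  next
    fix Z assume "Z \<in> nilpotents_of_type a"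
    then have "\<exists>g\<in>carrier GL. Z = Ad g X"
      using XT nil by (intro conjugate_if_equal_ranks[of X Z "length a"]) (auto simp: nilpotents_of_type_def)
    then show "Z \<in> nil_variety (Fl a)" unfolding nil_variety_def using F X by blast
  qed
qed

lemma nil_equivalent_Fl_iff:
  assumes "composition d a" "composition d b" "dim (UNIV :: 'v set) = d"
  shows "nil_equivalent (Fl a) (Fl b) \<longleftrightarrow> mset a = mset b"
proof -
  have a: "sum_list a = dim (UNIV :: 'v set)" "\<forall>x\<in>set a. 0 < x \<and> x \<le> d"
    and b: "sum_list b = dim (UNIV :: 'v set)" "\<forall>x\<in>set b. 0 < x \<and> x \<le> d"
    using assms member_le_sum_list[of _ a] member_le_sum_list[of _ b] by (auto simp: composition_def)
  have "nil_equivalent (Fl a) (Fl b) \<longleftrightarrow> nilpotents_of_type a = nilpotents_of_type b"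
    using nil_variety_Fl(1) a b by (simp add: nil_equivalent_def)
  also have "\<dots> \<longleftrightarrow> richardson_rank d a = richardson_rank d b"
  proof
    assume eq: "nilpotents_of_type a = nilpotents_of_type b"
    \<comment> \<open>The ranks of the powers of a single common element are prescribed by both
      compositions, so the two rank functions agree.\<close>
    obtain X where "X \<in> nilpotents_of_type a" using nil_variety_Fl(2)[OF a(1)] by blast
    moreover from this have "X \<in> nilpotents_of_type b" using eq by simp
    ultimately show "richardson_rank d a = richardson_rank d b"
      using assms(3) by (auto simp: nilpotents_of_type_def fun_eq_iff)
  qed (simp add: nilpotents_of_type_def flip: assms(3))
  also have "\<dots> \<longleftrightarrow> mset a = mset b" by (rule richardson_rank_eq_iff[OF a(2) b(2)])
  finally show ?thesis .
qed

end

theorem proposition5: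
  fixes scale :: "'k::{alg_closed_field, field_char_0} \<Rightarrow> 'v::ab_group_add \<Rightarrow> 'v"
    and Basis :: "'v set" and d :: nat and a b :: "nat list"
  assumes "finite_dimensional_vector_space scale Basis"
    and "vector_space.dim scale (UNIV :: 'v set) = d"
    and "composition d a" and "composition d b"
  shows "linear_group.nil_equivalent scale
           (linear_group.Fl scale a) (linear_group.Fl scale b) \<longleftrightarrow> a <~~> b"
proof -
  interpret finite_dimensional_vector_space scale Basis by (fact assms(1))
  interpret fin_linear_group scale Basis by unfold_locales
  show ?thesis using assms(2-4) by (intro nil_equivalent_Fl_iff)
qed

end
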